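(* Let $P\in H^2\setminus S^1$. There exist a continuous density $h_P:S^1\to\mathbb{R}$ and a constant $k_P\in[0,1)$ such that the assignment $$\Phi_P(\nu):=h_P\cdot\mathcal{H}^1_{S^1}+(1-k_P)\cdot\nu$$ defines a bijection $\Phi_P$ from the set of $\pi$-periodic measures $\nu\in\mathcal{P}_1(S^1)$ onto the set of measures $\mu\in\mathcal{P}_1(S^1)$ such that $d_W(\mu,\delta_Q)=d_{S^2}(P,Q)$ for all $Q\in S^1$.
   Context: $H^2$ denotes the closed hemisphere of the unit round sphere $S^2$ with the angular (spherical) distance $d_{S^2}$. $S^1$ is its boundary great circle with the restricted metric $d_{S^1}$ (the arc-length metric, total length $2\pi$). $\mathcal{P}_1(S^1)$ is the set of Borel probability measures on $S^1$ with the Wasserstein $1$-distance $d_W(\mu,\nu)=\inf_K\int_{S^1\times S^1}d_{S^1}(x,y)\,dK(x,y)$, the infimum over all couplings $K$ of $\mu$ and $\nu$. $\delta_Q$ is the Dirac measure at $Q$, and $\mathcal{H}^1_{S^1}$ is the $1$-dimensional Hausdorff (arc-length) measure on $S^1$. A measure $\nu$ on $S^1$ is $\pi$-periodic if it is invariant under the antipodal map $T:S^1\to S^1$, i.e. $T_*\nu=\nu$. *)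

theory Defs
  imports "HOL-Probability.Probability"
begin

definition S2 :: "(real^3) set" where
  "S2 = sphere 0 1"

definition H2 :: "(real^3) set" where
  "H2 = {x \<in> S2. 0 \<le> x $ 3}"

definition S1 :: "(real^3) set" where
  "S1 = {x \<in> S2. x $ 3 = 0}"

text \<open>Angular distance, meaningful for unit vectors only. Since \<open>S1\<close> is a great circle, the
  restriction of this distance to \<open>S1\<close> is the arc-length metric.\<close>

definition sph_dist :: "real^3 \<Rightarrow> real^3 \<Rightarrow> real" where
  "sph_dist x y = arccos (x \<bullet> y)"

definition S1_borel :: "(real^3) measure" where
  "S1_borel = restrict_space borel S1"

text \<open>The set \<open>\<P>\<^sub>1(S\<^sup>1)\<close>; a first-moment condition would be vacuous, \<open>S1\<close> being compact.\<close>

definition S1_probs :: "(real^3) measure set" where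
  "S1_probs = {\<mu>. sets \<mu> = sets S1_borel \<and> prob_space \<mu>}"

definition couplings :: "'a measure \<Rightarrow> 'b measure \<Rightarrow> ('a \<times> 'b) measure set" where
  "couplings \<mu> \<nu> = {K. sets K = sets (\<mu> \<Otimes>\<^sub>M \<nu>) \<and> distr K \<mu> fst = \<mu> \<and> distr K \<nu> snd = \<nu>}"

text \<open>For probability measures on \<open>S1\<close> the infimum is over a nonempty set (it contains the product
  measure) of integrals of a continuous function with values in \<open>[0, \<pi>]\<close>.\<close>

definition wasserstein1 :: "(real^3) measure \<Rightarrow> (real^3) measure \<Rightarrow> real" where
  "wasserstein1 \<mu> \<nu> = (INF K\<in>couplings \<mu> \<nu>. \<integral>z. sph_dist (fst z) (snd z) \<partial>K)"

definition sph_diam :: "(real^3) set \<Rightarrow> ennreal" where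
  "sph_diam U = (SUP x\<in>U. SUP y\<in>U. ennreal (sph_dist x y))"

text \<open>One-dimensional Hausdorff outer measure of the metric space \<open>(S1, sph_dist)\<close>. In dimension one
  the unnormalized sum of diameters already gives arc length.\<close>

definition hausdorff1_delta :: "real \<Rightarrow> (real^3) set \<Rightarrow> ennreal" where
  "hausdorff1_delta \<delta> A =
     (INF U\<in>{U :: nat \<Rightarrow> (real^3) set.
               A \<subseteq> (\<Union>i. U i) \<and> (\<forall>i. U i \<subseteq> S1 \<and> sph_diam (U i) \<le> ennreal \<delta>)}.
        \<Sum>i. sph_diam (U i))"

definition hausdorff1_outer :: "(real^3) set \<Rightarrow> ennreal" where
  "hausdorff1_outer A = (SUP \<delta>\<in>{0<..}. hausdorff1_delta \<delta> A)"

definition S1_hausdorff1 :: "(real^3) measure" where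
  "S1_hausdorff1 = measure_of S1 (sets S1_borel) hausdorff1_outer"

definition pi_periodic :: "(real^3) measure \<Rightarrow> bool" where
  "pi_periodic \<nu> \<longleftrightarrow> distr \<nu> S1_borel (\<lambda>x. - x) = \<nu>"

text \<open>Sum of two measures on the same \<open>\<sigma>\<close>-algebra.\<close>

definition add_measure :: "'a measure \<Rightarrow> 'a measure \<Rightarrow> 'a measure" where
  "add_measure M N = measure_of (space M) (sets M) (\<lambda>A. emeasure M A + emeasure N A)"

text \<open>\<open>h \<cdot> \<H>\<^sup>1 + (1 - k) \<cdot> \<nu>\<close>; to be read for \<open>h \<ge> 0\<close> on \<open>S1\<close> and \<open>k \<le> 1\<close>, since
  \<open>ennreal\<close> truncates negative reals.\<close>

definition Phi :: "(real^3 \<Rightarrow> real) \<Rightarrow> real \<Rightarrow> (real^3) measure \<Rightarrow> (real^3) measure" where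
  "Phi h k \<nu> =
     add_measure (density S1_hausdorff1 (\<lambda>x. ennreal (h x))) (scale_measure (ennreal (1 - k)) \<nu>)"

end

theory Submission
  imports Defs
begin

text \<open>The only coupling of \<open>\<mu>\<close> with \<open>\<delta>\<^sub>Q\<close> is the product, so the condition on \<open>\<mu>\<close> says that its distance
  potential \<open>\<integral> d(x, Q) d\<mu>(x)\<close> equals \<open>d(P, Q) = arccos (r cos u)\<close>, where \<open>r\<close> is the length of the
  projection of \<open>P\<close> to the plane of \<open>S1\<close> and \<open>u\<close> is the angle from that projection to \<open>Q\<close>. Formally, the second
  derivative of the potential in \<open>Q\<close> is \<open>2 (\<mu> - T\<^sub>*\<mu>)\<close>; hence the condition prescribes
  \<open>\<mu> - T\<^sub>*\<mu>\<close>, whose positive part \<open>h\<close> is half of the second derivative of \<open>arccos (r cos u)\<close> on the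
  semicircle \<open>\<bar>u\<bar> \<le> \<pi>/2\<close>, of total mass \<open>k = r\<close>. Thus \<open>\<mu> - h \<cdot> \<H>\<^sup>1\<close> is nonnegative and antipodally invariant.
  Rigorously, only first derivatives are used: a measure with constant potential gives the same mass to opposite
  half-open semicircles, hence is antipodally invariant, and this is applied to \<open>\<mu> + T\<^sub>*(h \<cdot> \<H>\<^sup>1)\<close>.\<close>

section \<open>The circle and distances to its points\<close>

definition circ :: "real \<Rightarrow> real^3" where
  "circ t = vector [cos t, sin t, 0]"

lemma inner_vec3: "x \<bullet> y = x $ 1 * y $ 1 + x $ 2 * y $ 2 + x $ 3 * y $ 3" for x y :: "real^3"
  by (simp add: inner_vec_def sum_3)

lemma S1_iff: "x \<in> S1 \<longleftrightarrow> x $ 3 = 0 \<and> (x $ 1)\<^sup>2 + (x $ 2)\<^sup>2 = 1"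
  by (auto simp: S1_def S2_def norm_eq_1 inner_vec3 power2_eq_square)

lemma circ_nth [simp]: "circ t $ 1 = cos t" "circ t $ 2 = sin t" "circ t $ 3 = 0"
  by (simp_all add: circ_def)

lemma circ_in_S1 [simp]: "circ t \<in> S1"
  by (simp add: S1_iff)

lemma vec3_eq_iff: "x = y \<longleftrightarrow> x $ 1 = y $ 1 \<and> x $ 2 = y $ 2 \<and> x $ 3 = y $ 3" for x y :: "real^3"
  by (simp add: vec_eq_iff forall_3)

lemma circ_eq_iff: "circ s = circ t \<longleftrightarrow> (\<exists>n::int. s = t + 2 * pi * n)"
  using sin_cos_eq_iff[of s t] by (auto simp: vec3_eq_iff)

lemma circ_add_2pi_int [simp]: "circ (t + 2 * pi * of_int n) = circ t"
  by (subst circ_eq_iff) blast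

lemma circ_minus_pi: "circ (t - pi) = - circ t" and circ_plus_pi: "circ (t + pi) = - circ t"
  by (simp_all add: vec3_eq_iff)

lemma inner_circ: "circ s \<bullet> circ t = cos (s - t)"
  by (simp add: inner_vec3 cos_diff)

text \<open>Any angle of \<open>x\<close> is shifted by full turns. The start \<open>a\<close> of
  the window stays free so that each use can cut the circle where its distance formulas become
  simplest.\<close>

lemma S1_E:
  assumes "x \<in> S1"
  obtains t where "a \<le> t" "t < a + 2 * pi" "x = circ t"
proof -
  obtain s where s: "x $ 1 = cos s" "x $ 2 = sin s"
    using assms sincos_total_2pi by (metis S1_iff)
  define n where "n = \<lfloor>(s - a) / (2 * pi)\<rfloor>"
  define t where "t = s + 2 * pi * of_int (- n)"
  have "of_int n \<le> (s - a) / (2 * pi)" "(s - a) / (2 * pi) < of_int n + 1"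
    unfolding n_def by linarith+
  then have "a \<le> t" "t < a + 2 * pi"
    by (simp_all add: t_def field_simps)
  moreover have "x = circ t"
    unfolding t_def circ_add_2pi_int using s assms by (simp add: vec3_eq_iff S1_iff)
  ultimately show ?thesis using that by blast
qed

lemma S1_inner_bounds:
  assumes "x \<in> S1" "y \<in> S1"
  shows "-1 \<le> x \<bullet> y" "x \<bullet> y \<le> 1"
proof -
  have "\<bar>x \<bullet> y\<bar> \<le> norm x * norm y" by (rule Cauchy_Schwarz_ineq2)
  then show "-1 \<le> x \<bullet> y" "x \<bullet> y \<le> 1"
    using assms by (auto simp: S1_def S2_def)
qed

lemma uminus_S1 [simp]: "- x \<in> S1 \<longleftrightarrow> x \<in> S1"
  by (simp add: S1_iff)

lemma sph_dist_S1_nonneg: "x \<in> S1 \<Longrightarrow> y \<in> S1 \<Longrightarrow> 0 \<le> sph_dist x y"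
  and sph_dist_S1_le_pi: "x \<in> S1 \<Longrightarrow> y \<in> S1 \<Longrightarrow> sph_dist x y \<le> pi"
  unfolding sph_dist_def by (simp_all add: S1_inner_bounds arccos_lbound arccos_ubound)

lemma sph_dist_uminus_left: "x \<in> S1 \<Longrightarrow> y \<in> S1 \<Longrightarrow> sph_dist (- x) y = pi - sph_dist x y"
  and sph_dist_uminus_right: "x \<in> S1 \<Longrightarrow> y \<in> S1 \<Longrightarrow> sph_dist x (- y) = pi - sph_dist x y"
  unfolding sph_dist_def using S1_inner_bounds[of x y] by (simp_all add: arccos_minus)

lemma sph_dist_circ: "sph_dist (circ s) (circ t) = arccos (cos (s - t))"
  by (simp add: sph_dist_def inner_circ)

lemma sph_dist_circ_abs: "\<bar>s - t\<bar> \<le> pi \<Longrightarrow> sph_dist (circ s) (circ t) = \<bar>s - t\<bar>"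
  by (simp add: sph_dist_circ arccos_cos_eq_abs)

section \<open>Borel structure of the circle and measurability of the distance\<close>

lemma closed_S1: "closed S1"
proof -
  have "S1 = sphere 0 1 \<inter> {x. x $ 3 = 0}"
    by (auto simp: S1_def S2_def)
  moreover have "closed {x::real^3. x $ 3 = 0}"
    by (intro closed_Collect_eq continuous_intros)
  ultimately show ?thesis by (metis closed_Int closed_sphere)
qed

lemma space_S1_borel [simp]: "space S1_borel = S1"
  by (simp add: S1_borel_def space_restrict_space)

lemma sets_S1_borel_iff: "A \<in> sets S1_borel \<longleftrightarrow> A \<in> sets borel \<and> A \<subseteq> S1"
  unfolding S1_borel_def using closed_S1 by (subst sets_restrict_space_iff) auto

lemma measurable_S1_borelI:
  "f \<in> M \<rightarrow>\<^sub>M borel \<Longrightarrow> (\<And>x. x \<in> space M \<Longrightarrow> f x \<in> S1) \<Longrightarrow> f \<in> M \<rightarrow>\<^sub>M S1_borel"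
  unfolding S1_borel_def by (rule measurable_restrict_space2) auto

lemma borel_measurable_S1:
  assumes "f \<in> borel_measurable borel" "sets M = sets S1_borel"
  shows "f \<in> borel_measurable M"
  using measurable_restrict_space1[OF assms(1), of S1]
  unfolding measurable_cong_sets[OF assms(2) refl] S1_borel_def .

lemma continuous_circ: "continuous_on X circ"
proof -
  have "circ = (\<lambda>t. cos t *\<^sub>R axis 1 1 + sin t *\<^sub>R axis 2 1)"
    by (auto simp: fun_eq_iff vec3_eq_iff axis_def)
  then show ?thesis by (subst \<open>circ = _\<close>) (intro continuous_intros)
qed

lemma measurable_circ [measurable]: "circ \<in> borel \<rightarrow>\<^sub>M S1_borel"
  by (rule measurable_S1_borelI) (auto intro: borel_measurable_continuous_onI continuous_circ)

lemma measurable_uminus_S1: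
  assumes "sets M = sets S1_borel"
  shows "uminus \<in> M \<rightarrow>\<^sub>M S1_borel"
proof (rule measurable_S1_borelI)
  show "uminus \<in> borel_measurable M"
    by (rule borel_measurable_S1[OF _ assms]) measurable
  show "- x \<in> S1" if "x \<in> space M" for x
    using that sets_eq_imp_space_eq[OF assms] by simp
qed

text \<open>\<open>arccos\<close> is well behaved only on [-1, 1]. Clamping its argument writes the
  distance as a composition of continuous functions defined everywhere, which yields Borel
  measurability.\<close>

lemma sph_dist_truncate:
  "x \<in> S1 \<Longrightarrow> y \<in> S1 \<Longrightarrow> sph_dist x y = arccos (max (-1) (min 1 (x \<bullet> y)))"
  using S1_inner_bounds[of x y] by (simp add: sph_dist_def)

lemma continuous_arccos_truncate: "continuous_on UNIV (\<lambda>t::real. arccos (max (-1) (min 1 t)))"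
  by (rule continuous_on_compose2[OF continuous_on_arccos']) (auto intro!: continuous_intros)

lemma measurable_sph_dist:
  assumes Q: "Q \<in> S1" and M: "sets M = sets S1_borel"
  shows "(\<lambda>x. sph_dist x Q) \<in> borel_measurable M"
proof -
  have [measurable]: "(\<lambda>t::real. arccos (max (-1) (min 1 t))) \<in> borel_measurable borel"
    using continuous_arccos_truncate by (rule borel_measurable_continuous_onI)
  have "(\<lambda>x. arccos (max (-1) (min 1 (x \<bullet> Q)))) \<in> borel_measurable M"
    by (rule borel_measurable_S1[OF _ M]) simp
  then show ?thesis
    using Q sets_eq_imp_space_eq[OF M]
    by (subst measurable_cong[where g="\<lambda>x. arccos (max (-1) (min 1 (x \<bullet> Q)))"])
      (auto simp: sph_dist_truncate)
qed

lemma measurable_sph_dist_pair: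
  "(\<lambda>z. sph_dist (fst z) (snd z)) \<in> borel_measurable (S1_borel \<Otimes>\<^sub>M S1_borel)"
proof -
  have [measurable]: "(\<lambda>t::real. arccos (max (-1) (min 1 t))) \<in> borel_measurable borel"
    using continuous_arccos_truncate by (rule borel_measurable_continuous_onI)
  have [measurable]: "(\<lambda>x. x) \<in> S1_borel \<rightarrow>\<^sub>M borel"
    by (rule borel_measurable_S1) auto
  have [measurable]: "fst \<in> S1_borel \<Otimes>\<^sub>M S1_borel \<rightarrow>\<^sub>M borel" "snd \<in> S1_borel \<Otimes>\<^sub>M S1_borel \<rightarrow>\<^sub>M borel"
    using measurable_comp[OF measurable_fst, of "\<lambda>x. x" S1_borel S1_borel borel]
      measurable_comp[OF measurable_snd, of "\<lambda>x. x" S1_borel S1_borel borel] by (simp_all add: comp_def)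
  have "(\<lambda>z. arccos (max (-1) (min 1 (fst z \<bullet> snd z)))) \<in> borel_measurable (S1_borel \<Otimes>\<^sub>M S1_borel)"
    by measurable
  then show ?thesis
    by (subst measurable_cong[where g="\<lambda>z. arccos (max (-1) (min 1 (fst z \<bullet> snd z)))"])
      (auto simp: sph_dist_truncate space_pair_measure)
qed

text \<open>The second marginal of a coupling forces its second coordinate to equal \<open>Q\<close>
  almost everywhere, so all couplings have the same cost and the infimum runs over a single value.
  The nonnegative integral on the right adds up over sums of measures without integrability
  conditions.\<close>

lemma wasserstein1_return:
  assumes \<mu>: "\<mu> \<in> S1_probs" and Q: "Q \<in> S1"
  shows "wasserstein1 \<mu> (return S1_borel Q) = enn2real (\<integral>\<^sup>+x. ennreal (sph_dist x Q) \<partial>\<mu>)"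
proof -
  let ?\<delta> = "return S1_borel Q"
  have sets_\<mu> [measurable_cong]: "sets \<mu> = sets S1_borel" and "prob_space \<mu>"
    using \<mu> by (auto simp: S1_probs_def)
  interpret \<mu>: prob_space \<mu> by fact
  interpret \<delta>: prob_space ?\<delta> using Q by (intro prob_space_return) simp
  interpret pair_prob_space \<mu> ?\<delta> ..
  have space_\<mu>: "space \<mu> = S1" using sets_eq_imp_space_eq[OF sets_\<mu>] by simp
  have "distr (\<mu> \<Otimes>\<^sub>M ?\<delta>) ?\<delta> snd = ?\<delta>"
  proof (rule measure_eqI)
    fix A assume A: "A \<in> sets (distr (\<mu> \<Otimes>\<^sub>M ?\<delta>) ?\<delta> snd)"
    then have "snd -` A \<inter> space (\<mu> \<Otimes>\<^sub>M ?\<delta>) = space \<mu> \<times> A"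
      using sets.sets_into_space[of A ?\<delta>] by (auto simp: space_pair_measure)
    then show "emeasure (distr (\<mu> \<Otimes>\<^sub>M ?\<delta>) ?\<delta> snd) A = emeasure ?\<delta> A"
      using A by (subst emeasure_distr[OF measurable_snd])
        (simp_all add: \<delta>.emeasure_pair_measure_Times \<mu>.emeasure_space_1)
  qed simp
  \<comment> \<open>A witness is needed to make the set of costs a singleton and not empty.\<close>
  then have ne: "\<mu> \<Otimes>\<^sub>M ?\<delta> \<in> couplings \<mu> ?\<delta>"
    unfolding couplings_def using \<delta>.distr_pair_fst[of \<mu>] by blast
  have "(\<integral>z. sph_dist (fst z) (snd z) \<partial>K) = (\<integral>x. sph_dist x Q \<partial>\<mu>)"
    if K: "K \<in> couplings \<mu> ?\<delta>" for K
  proof -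
    have sets_K: "sets K = sets (S1_borel \<Otimes>\<^sub>M S1_borel)"
      using K sets_pair_measure_cong[of \<mu> S1_borel ?\<delta> S1_borel] sets_\<mu> by (auto simp: couplings_def)
    have fst: "fst \<in> K \<rightarrow>\<^sub>M \<mu>" and snd: "snd \<in> K \<rightarrow>\<^sub>M ?\<delta>"
      using sets_\<mu> by (auto simp: measurable_cong_sets[OF sets_K refl] cong: measurable_cong_sets)
    have "{Q} \<in> sets ?\<delta>" using Q by (simp add: sets_S1_borel_iff)
    moreover have "AE y in ?\<delta>. y = Q"
      by (rule AE_I[where N="S1 - {Q}"])
         (use Q closed_S1 in \<open>auto simp: sets_S1_borel_iff emeasure_return\<close>)
    moreover have "distr K ?\<delta> snd = ?\<delta>" using K unfolding couplings_def by blast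
    ultimately have "AE y in distr K ?\<delta> snd. y = Q" by (subst \<open>distr K ?\<delta> snd = ?\<delta>\<close>)
    then have AE: "AE z in K. snd z = Q"
      by (subst (asm) AE_distr_iff[OF snd]) (use \<open>{Q} \<in> sets ?\<delta>\<close> Q in \<open>auto simp: Collect_conv_if\<close>)
    have m1: "(\<lambda>z. sph_dist (fst z) (snd z)) \<in> borel_measurable K"
      using measurable_sph_dist_pair by (simp cong: measurable_cong_sets add: sets_K)
    have m2: "(\<lambda>z. sph_dist (fst z) Q) \<in> borel_measurable K"
      by (rule measurable_compose[OF fst measurable_sph_dist[OF Q sets_\<mu>]])
    have "(\<integral>z. sph_dist (fst z) (snd z) \<partial>K) = (\<integral>z. sph_dist (fst z) Q \<partial>K)"
      using AE by (intro integral_cong_AE m1 m2) auto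
    also have "\<dots> = (\<integral>x. sph_dist x Q \<partial>distr K \<mu> fst)"
      by (rule integral_distr[symmetric, OF fst measurable_sph_dist[OF Q sets_\<mu>]])
    also have "distr K \<mu> fst = \<mu>" using K unfolding couplings_def by blast
    finally show ?thesis .
  qed
  then have "(\<lambda>K. \<integral>z. sph_dist (fst z) (snd z) \<partial>K) ` couplings \<mu> ?\<delta> = {\<integral>x. sph_dist x Q \<partial>\<mu>}"
    using ne by auto
  then have "wasserstein1 \<mu> ?\<delta> = (\<integral>x. sph_dist x Q \<partial>\<mu>)"
    by (simp add: wasserstein1_def)
  also have "\<dots> = enn2real (\<integral>\<^sup>+x. ennreal (sph_dist x Q) \<partial>\<mu>)"
    by (rule integral_eq_nn_integral[OF measurable_sph_dist[OF Q sets_\<mu>]])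
      (auto simp: space_\<mu> Q sph_dist_S1_nonneg)
  finally show ?thesis .
qed

section \<open>Sums of measures\<close>

lemma sets_add_measure [simp]: "sets (add_measure M N) = sets M"
  and space_add_measure [simp]: "space (add_measure M N) = space M"
  by (simp_all add: add_measure_def)

lemma emeasure_add_measure:
  assumes "sets N = sets M" "A \<in> sets M"
  shows "emeasure (add_measure M N) A = emeasure M A + emeasure N A"
  unfolding add_measure_def
proof (rule emeasure_measure_of_sigma)
  show "countably_additive (sets M) (\<lambda>A. emeasure M A + emeasure N A)"
    unfolding countably_additive_def using assms(1)
    by (auto simp: suminf_emeasure[symmetric] suminf_add[symmetric] intro!: summableI)
qed (use assms in \<open>auto simp: positive_def sets.sigma_algebra_axioms\<close>)

lemma nn_integral_add_measure:
  assumes f: "f \<in> borel_measurable M" and N: "sets N = sets M"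
  shows "integral\<^sup>N (add_measure M N) f = integral\<^sup>N M f + integral\<^sup>N N f"
  using f
proof induction
  case (cong f g)
  then show ?case
    using sets_eq_imp_space_eq[OF N] by (simp cong: nn_integral_cong_simp)
next
  case (set A)
  then show ?case using N by (simp add: emeasure_add_measure)
next
  case (mult u c)
  then show ?case using N
    by (simp add: nn_integral_cmult distrib_left cong: measurable_cong_sets)
next
  case (add u v)
  then show ?case using N
    by (simp add: nn_integral_add ac_simps cong: measurable_cong_sets)
next
  case (seq U)
  have meas: "U i \<in> borel_measurable N" "U i \<in> borel_measurable (add_measure M N)" for i
    using seq N by (auto cong: measurable_cong_sets)
  have "(SUP i. integral\<^sup>N M (U i) + integral\<^sup>N N (U i))
      = (SUP i. integral\<^sup>N M (U i)) + (SUP i. integral\<^sup>N N (U i))"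
    using \<open>incseq U\<close> by (intro ennreal_SUP_add) (auto simp: incseq_def le_fun_def intro!: nn_integral_mono)
  then show ?case
    using seq meas by (simp add: nn_integral_monotone_convergence_SUP image_comp SUP_apply[abs_def])
qed

section \<open>Hausdorff measure of the circle\<close>

lemma sph_dist_le_sph_diam:
  assumes "x \<in> U" "y \<in> U"
  shows "ennreal (sph_dist x y) \<le> sph_diam U"
  unfolding sph_diam_def using assms by (intro SUP_upper2[of x] SUP_upper2[of y]) auto

lemma sph_diam_circ_image:
  assumes "I \<subseteq> {a..b}" "b - a \<le> pi"
  shows "sph_diam (circ ` I) \<le> ennreal (b - a)"
  unfolding sph_diam_def
proof (intro SUP_least)
  fix x y assume "x \<in> circ ` I" "y \<in> circ ` I"
  then obtain s t where "s \<in> {a..b}" "t \<in> {a..b}" "x = circ s" "y = circ t"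
    using assms(1) by (metis imageE subsetD)
  then show "ennreal (sph_dist x y) \<le> ennreal (b - a)"
    using assms(2) by (intro ennreal_leI) (auto simp: sph_dist_circ_abs)
qed

section \<open>Comparison of Hausdorff measure with Lebesgue measure of the angles\<close>

lemma measurable_circ_shift [measurable]: "(\<lambda>u. circ (\<phi> + u)) \<in> borel \<rightarrow>\<^sub>M S1_borel"
  by measurable

lemma sets_circ_vimage:
  assumes "A \<in> sets S1_borel"
  shows "{u \<in> {-pi..<pi}. circ (\<phi> + u) \<in> A} \<in> sets borel"
proof -
  have "(\<lambda>u. circ (\<phi> + u)) -` A \<inter> space borel \<in> sets borel"
    using measurable_circ_shift assms by (rule measurable_sets)
  then have "{-pi..<pi} \<inter> ((\<lambda>u. circ (\<phi> + u)) -` A \<inter> space borel) \<in> sets borel"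
    by (rule sets.Int[rotated]) simp
  moreover have "{-pi..<pi} \<inter> ((\<lambda>u. circ (\<phi> + u)) -` A \<inter> space borel)
      = {u \<in> {-pi..<pi}. circ (\<phi> + u) \<in> A}" by auto
  ultimately show ?thesis by simp
qed

text \<open>By outer regularity the angles of \<open>A\<close> lie in an open set \<open>G\<close>
  of barely larger measure. The covering lemma covers them by countably many short, nonoverlapping
  intervals inside \<open>G\<close>, and the corresponding arcs form an admissible cover whose
  diameters sum to at most the measure of \<open>G\<close>.\<close>

lemma hausdorff1_outer_le:
  assumes A: "A \<in> sets S1_borel"
  shows "hausdorff1_outer A \<le> emeasure lborel {u \<in> {-pi..<pi}. circ (\<phi> + u) \<in> A}" (is "_ \<le> emeasure _ ?N")
  unfolding hausdorff1_outer_def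
proof (rule SUP_least, rule ennreal_le_epsilon)
  fix \<delta> e :: real assume "\<delta> \<in> {0<..}" "0 < e"
  have N: "?N \<in> sets borel" by (rule sets_circ_vimage[OF A])
  obtain G where G: "open G" "?N \<subseteq> G" "emeasure lborel (G - ?N) < e"
    by (rule outer_regular_lborel[OF N \<open>0 < e\<close>])
  \<comment> \<open>An interval inside a ball of radius \<open>\<rho>\<close> has length at most
    \<open>\<delta>\<close>, as the cover requires, and at most \<open>pi\<close>, so that the
    diameter of its arc is bounded by its length. The second factor of \<open>g\<close> keeps the
    intervals tagged in \<open>?N\<close> inside \<open>G\<close>; at points outside
    \<open>G\<close> it is \<open>UNIV\<close>, so that \<open>g\<close> remains a gauge.\<close>
  define \<rho> where "\<rho> = min \<delta> pi / 2"
  define g where "g x = ball x \<rho> \<inter> (if x \<in> G then G else UNIV)" for x :: real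
  have "0 < \<rho>" using \<open>\<delta> \<in> _\<close> by (simp add: \<rho>_def)
  then have "gauge g" using G by (auto simp: gauge_def g_def)
  have "?N \<subseteq> cbox (-pi) pi" by auto
  moreover have "box (-pi) pi \<noteq> {}" using pi_gt_zero by (auto simp del: pi_gt_zero)
  ultimately obtain D where D: "countable D"
      "\<And>K. K \<in> D \<Longrightarrow> interior K \<noteq> {} \<and> (\<exists>c d. K = cbox c d)"
      "pairwise (\<lambda>A B. interior A \<inter> interior B = {}) D"
      "\<And>K. K \<in> D \<Longrightarrow> \<exists>x\<in>?N \<inter> K. K \<subseteq> g x"
      "?N \<subseteq> \<Union>D"
    by (rule covering_lemma[OF _ _ \<open>gauge g\<close>]) (rule that; assumption)
  define E where "E n = (if n \<in> to_nat_on D ` D then from_nat_into D n else {})" for n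
  have E_D: "E n \<in> D" "n = to_nat_on D (E n)" if "E n \<noteq> {}" for n
  proof -
    obtain K where "K \<in> D" "n = to_nat_on D K"
      using \<open>E n \<noteq> {}\<close> unfolding E_def by (metis imageE)
    moreover from this have "E n = K" using D(1) by (simp add: E_def)
    ultimately show "E n \<in> D" "n = to_nat_on D (E n)" by simp_all
  qed
  have E_to_nat: "E (to_nat_on D K) = K" if "K \<in> D" for K
    using that D(1) by (auto simp: E_def)
  define V where "V n = circ ` (\<lambda>u. \<phi> + u) ` E n" for n
  \<comment> \<open>Members of \<open>D\<close> may share endpoints. Their interiors have the same
    length and are disjoint, so these lengths add up to the measure of a union.\<close>
  have V_small: "sph_diam (V n) \<le> ennreal \<delta> \<and> sph_diam (V n) \<le> emeasure lborel (interior (E n))" for n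
  proof (cases "E n = {}")
    case True
    then show ?thesis by (simp add: V_def sph_diam_def bot_ennreal)
  next
    case False
    then obtain a b where ab: "E n = cbox a b" using E_D D(2) by blast
    with False have "a \<le> b" by simp
    obtain x where x: "E n \<subseteq> g x" using E_D(1)[OF False] D(4) by blast
    then have "a \<in> ball x \<rho>" "b \<in> ball x \<rho>" using ab \<open>a \<le> b\<close> by (auto simp: g_def)
    then have "b - a \<le> 2 * \<rho>" by (auto simp: dist_real_def)
    then have "b - a \<le> pi" "b - a \<le> \<delta>" by (auto simp: \<rho>_def)
    then have "sph_diam (V n) \<le> ennreal ((\<phi> + b) - (\<phi> + a))"
      unfolding V_def by (intro sph_diam_circ_image) (auto simp: ab)
    moreover have "emeasure lborel (interior (E n)) = ennreal (b - a)"
      using \<open>a \<le> b\<close> by (simp add: ab)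
    moreover have "ennreal (b - a) \<le> ennreal \<delta>" using \<open>b - a \<le> \<delta>\<close> by (rule ennreal_leI)
    ultimately show ?thesis by auto
  qed
  have "hausdorff1_delta \<delta> A \<le> (\<Sum>i. sph_diam (V i))"
    unfolding hausdorff1_delta_def
  proof (rule INF_lower, intro CollectI conjI allI)
    show "A \<subseteq> (\<Union>i. V i)"
    proof
      fix x assume "x \<in> A"
      then have "x \<in> S1" using A by (auto simp: sets_S1_borel_iff)
      then obtain t where t: "\<phi> - pi \<le> t" "t < \<phi> - pi + 2 * pi" "x = circ t"
        by (rule S1_E)
      then have "t - \<phi> \<in> ?N" using \<open>x \<in> A\<close> by auto
      then obtain K where "K \<in> D" "t - \<phi> \<in> K" using D(5) by blast
      then have "x \<in> V (to_nat_on D K)"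
        unfolding V_def E_to_nat[OF \<open>K \<in> D\<close>] using t(3) by (intro image_eqI[of _ _ t] image_eqI[of _ _ "t - \<phi>"]; simp)
      then show "x \<in> (\<Union>i. V i)" by blast
    qed
    show "V i \<subseteq> S1" "sph_diam (V i) \<le> ennreal \<delta>" for i
      using V_small by (auto simp: V_def)
  qed
  also have "\<dots> \<le> (\<Sum>i. emeasure lborel (interior (E i)))"
    using V_small by (intro suminf_le summableI) auto
  also have "\<dots> = emeasure lborel (\<Union>i. interior (E i))"
  proof (rule suminf_emeasure)
    show "disjoint_family (\<lambda>i. interior (E i))"
      unfolding disjoint_family_on_def
    proof (intro ballI impI)
      fix m n :: nat assume "m \<noteq> n"
      show "interior (E m) \<inter> interior (E n) = {}"
      proof (cases "E m = {} \<or> E n = {}")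
        case False
        then have "E m \<noteq> E n" using \<open>m \<noteq> n\<close> E_D(2) by metis
        then show ?thesis using D(3) False E_D(1) by (auto simp: pairwise_def)
      qed auto
    qed
  qed auto
  also have "\<dots> \<le> emeasure lborel G"
  proof (rule emeasure_mono)
    have "E n \<subseteq> G" for n
    proof (cases "E n = {}")
      case False
      then obtain x where "x \<in> ?N" "E n \<subseteq> g x" using E_D(1) D(4) by blast
      then show ?thesis using G(2) by (auto simp: g_def split: if_splits)
    qed simp
    then show "(\<Union>i. interior (E i)) \<subseteq> G" using interior_subset by blast
  qed (use G in auto)
  also have "\<dots> \<le> emeasure lborel (?N \<union> (G - ?N))"
    by (rule emeasure_mono) (use N G in \<open>auto intro!: sets.Un sets.Diff\<close>)
  also have "\<dots> \<le> emeasure lborel ?N + emeasure lborel (G - ?N)"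
    by (rule emeasure_subadditive) (use N G in auto)
  also have "\<dots> \<le> emeasure lborel ?N + e"
    using G(3) by (intro add_left_mono) simp
  finally show "hausdorff1_delta \<delta> A \<le> emeasure lborel ?N + e" .
qed

text \<open>A set of diameter at most 1 lies on an arc of that length; cutting the circle open at
  \<open>\<phi> \<plusminus> \<pi>\<close> may split the arc into two intervals.\<close>

lemma small_set_arc_cover:
  assumes V: "V \<subseteq> S1" "sph_diam V \<le> 1"
  obtains W where "W \<in> sets borel" "{u \<in> {-pi..<pi}. circ (\<phi> + u) \<in> V} \<subseteq> W"
    "emeasure lborel W \<le> sph_diam V"
proof (cases "V = {}")
  case True
  then show ?thesis using that[of "{}"] by auto
next
  case False
  then obtain x\<^sub>0 where "x\<^sub>0 \<in> V" by blast
  then obtain t\<^sub>0 where t\<^sub>0: "x\<^sub>0 = circ t\<^sub>0" using V by (metis S1_E subsetD)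
  define d where "d = enn2real (sph_diam V)"
  have diam: "sph_diam V = ennreal d"
    unfolding d_def using V(2) le_less_trans[OF _ ennreal_one_less_top] by (intro ennreal_enn2real[symmetric]) auto
  have "0 \<le> d" by (simp add: d_def)
  have "d \<le> 1" using V(2) diam by simp
  have le_d: "sph_dist x y \<le> d" if "x \<in> V" "y \<in> V" for x y
    using sph_dist_le_sph_diam[OF that] \<open>0 \<le> d\<close> by (simp add: diam)
  \<comment> \<open>Angles of points of \<open>V\<close> relative to \<open>x\<^sub>0\<close>. As
    \<open>d \<le> 1\<close>, the window [-1, 1] catches all of \<open>V\<close>, and angles in it
    differ by at most 2, which is below \<open>pi\<close>, so distances are plain
    differences.\<close>
  define L where "L = {\<tau> \<in> {-1..1}. circ (t\<^sub>0 + \<tau>) \<in> V}"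
  have "0 \<in> L" using \<open>x\<^sub>0 \<in> V\<close> t\<^sub>0 by (simp add: L_def)
  have "bdd_below L" by (rule bdd_belowI[of _ "-1"]) (auto simp: L_def)
  define s where "s = Inf L"
  have L_diam: "\<tau> - d \<le> \<tau>'" if "\<tau> \<in> L" "\<tau>' \<in> L" for \<tau> \<tau>'
  proof -
    have "\<bar>\<tau> - \<tau>'\<bar> \<le> pi" using that pi_gt3 by (auto simp: L_def)
    then have "sph_dist (circ (t\<^sub>0 + \<tau>)) (circ (t\<^sub>0 + \<tau>')) = \<bar>\<tau> - \<tau>'\<bar>"
      by (subst sph_dist_circ_abs) auto
    moreover have "sph_dist (circ (t\<^sub>0 + \<tau>)) (circ (t\<^sub>0 + \<tau>')) \<le> d"
      using that by (intro le_d) (auto simp: L_def)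
    ultimately show ?thesis by linarith
  qed
  have L_s: "0 \<le> \<tau> - s \<and> \<tau> - s \<le> d" if "\<tau> \<in> L" for \<tau>
  proof -
    have "s \<le> \<tau>" unfolding s_def using that \<open>bdd_below L\<close> by (rule cInf_lower)
    moreover have "\<tau> - d \<le> s"
      unfolding s_def by (rule cInf_greatest) (use \<open>0 \<in> L\<close> L_diam that in auto)
    ultimately show ?thesis by simp
  qed
  obtain s' where s': "\<phi> - pi \<le> s'" "s' < \<phi> - pi + 2 * pi" "circ (t\<^sub>0 + s) = circ s'"
    by (rule S1_E[OF circ_in_S1])
  define a where "a = s' - \<phi>"
  have a: "-pi \<le> a" "a < pi" using s' by (auto simp: a_def)
  obtain n :: int where n: "t\<^sub>0 + s = s' + 2 * pi * n" using s'(3) circ_eq_iff by blast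
  \<comment> \<open>The arc starts at \<open>a\<close> and has length \<open>d\<close>. What runs
    past \<open>pi\<close> reappears at \<open>-pi\<close>; the second interval is that piece and is
    empty if \<open>a + d < pi\<close>.\<close>
  define W where "W = {a..min (a + d) pi} \<union> {-pi..a + d - 2 * pi}"
  show ?thesis
  proof
    show "W \<in> sets borel" by (simp add: W_def)
    show "{u \<in> {-pi..<pi}. circ (\<phi> + u) \<in> V} \<subseteq> W"
    proof
      fix u assume "u \<in> {u \<in> {-pi..<pi}. circ (\<phi> + u) \<in> V}"
      then have u: "-pi \<le> u" "u < pi" "circ (\<phi> + u) \<in> V" by auto
      obtain t where t: "t\<^sub>0 - pi \<le> t" "t < t\<^sub>0 - pi + 2 * pi" "circ (\<phi> + u) = circ t"
        by (rule S1_E[OF circ_in_S1, of "t\<^sub>0 - pi" "\<phi> + u"])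
      have "\<bar>t - t\<^sub>0\<bar> \<le> d"
        using le_d[OF u(3) \<open>x\<^sub>0 \<in> V\<close>] t sph_dist_circ_abs[of t t\<^sub>0] by (auto simp: t\<^sub>0)
      then have "t - t\<^sub>0 \<in> L" using u(3) t(3) \<open>d \<le> 1\<close> by (auto simp: L_def)
      define w where "w = t - t\<^sub>0 - s"
      have w: "0 \<le> w" "w \<le> d" using L_s[OF \<open>t - t\<^sub>0 \<in> L\<close>] by (auto simp: w_def)
      obtain m :: int where m: "\<phi> + u = t + 2 * pi * m" using t(3) circ_eq_iff by blast
      define k where "k = m + n"
      have uk: "u = a + w + 2 * pi * k"
        using m n by (simp add: a_def w_def k_def algebra_simps)
      \<comment> \<open>Both \<open>a\<close> and \<open>u\<close> lie in [-pi, pi) and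
        \<open>0 \<le> w \<le> 1\<close>, so \<open>a + w\<close> and \<open>u\<close> agree or
        differ by one full turn.\<close>
      have "k = 0 \<or> k = -1"
      proof (rule ccontr)
        assume "\<not> (k = 0 \<or> k = -1)"
        then consider "1 \<le> k" | "k \<le> -2" by linarith
        then show False
        proof cases
          case 1
          then have "2 * pi * 1 \<le> 2 * pi * real_of_int k" by (intro mult_left_mono) auto
          then show False using uk u a w by linarith
        next
          case 2
          then have "2 * pi * real_of_int k \<le> 2 * pi * (-2)" by (intro mult_left_mono) auto
          then show False using uk u a w \<open>d \<le> 1\<close> pi_gt3 by linarith
        qed
      qed
      then show "u \<in> W" using uk u w by (auto simp: W_def)
    qed
    have "emeasure lborel W \<le> emeasure lborel {a..min (a + d) pi} + emeasure lborel {-pi..a + d - 2 * pi}"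
      unfolding W_def by (rule emeasure_subadditive) auto
    also have "\<dots> \<le> ennreal d"
      using a \<open>0 \<le> d\<close> by (auto simp: min_def emeasure_lborel_Icc_eq simp flip: ennreal_plus)
    finally show "emeasure lborel W \<le> sph_diam V" by (simp add: diam)
  qed
qed

text \<open>Each set of a cover is replaced by a Borel set of angles no longer than its diameter,
  and countable subadditivity bounds the sum. The single scale 1 is enough because the outer measure
  is the supremum over all scales.\<close>

lemma hausdorff1_outer_ge:
  "emeasure lborel {u \<in> {-pi..<pi}. circ (\<phi> + u) \<in> A} \<le> hausdorff1_outer A"
proof -
  let ?N = "\<lambda>A. {u \<in> {-pi..<pi}. circ (\<phi> + u) \<in> A}"
  have "emeasure lborel (?N A) \<le> hausdorff1_delta 1 A"
    unfolding hausdorff1_delta_def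
  proof (rule INF_greatest)
    fix U :: "nat \<Rightarrow> (real^3) set"
    assume "U \<in> {U. A \<subseteq> (\<Union>i. U i) \<and> (\<forall>i. U i \<subseteq> S1 \<and> sph_diam (U i) \<le> ennreal 1)}"
    then have U: "A \<subseteq> (\<Union>i. U i)" "\<And>i. U i \<subseteq> S1" "\<And>i. sph_diam (U i) \<le> 1" by auto
    have "\<exists>W. W \<in> sets borel \<and> ?N (U i) \<subseteq> W \<and> emeasure lborel W \<le> sph_diam (U i)" for i
      by (rule small_set_arc_cover[OF U(2,3)[of i], of \<phi>]) (intro exI conjI)
    then have "\<exists>W. \<forall>i. W i \<in> sets borel \<and> ?N (U i) \<subseteq> W i \<and> emeasure lborel (W i) \<le> sph_diam (U i)"
      by (intro choice allI)
    then obtain W where "\<forall>i. W i \<in> sets borel \<and> ?N (U i) \<subseteq> W i \<and> emeasure lborel (W i) \<le> sph_diam (U i)"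
      by (rule exE)
    then have W: "\<And>i. W i \<in> sets borel" "\<And>i. ?N (U i) \<subseteq> W i"
        "\<And>i. emeasure lborel (W i) \<le> sph_diam (U i)" by blast+
    have "?N A \<subseteq> (\<Union>i. W i)"
    proof
      fix u assume u: "u \<in> ?N A"
      then obtain i where "circ (\<phi> + u) \<in> U i" using U(1) by blast
      then have "u \<in> ?N (U i)" using u by simp
      then show "u \<in> (\<Union>i. W i)" using W(2)[of i] by (intro UN_I[of i]) (simp, rule subsetD)
    qed
    then have "emeasure lborel (?N A) \<le> emeasure lborel (\<Union>i. W i)"
      using W(1) by (intro emeasure_mono) auto
    also have "\<dots> \<le> (\<Sum>i. emeasure lborel (W i))"
      using W(1) by (intro emeasure_subadditive_countably) auto
    also have "\<dots> \<le> (\<Sum>i. sph_diam (U i))"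
      using W(3) by (intro suminf_le summableI) auto
    finally show "emeasure lborel (?N A) \<le> (\<Sum>i. sph_diam (U i))" .
  qed
  also have "\<dots> \<le> hausdorff1_outer A"
    unfolding hausdorff1_outer_def by (rule SUP_upper) simp
  finally show ?thesis .
qed

text \<open>The two bounds identify the outer measure on Borel sets with the image of Lebesgue
  measure. Countable additivity is thereby inherited, so \<open>measure_of\<close> yields a measure
  with these values. The base angle \<open>\<phi>\<close> is free and can later be the direction of
  the projection of \<open>P\<close>.\<close>

lemma S1_hausdorff1_eq_distr:
  "S1_hausdorff1 = distr (restrict_space lborel {-pi..<pi}) S1_borel (\<lambda>u. circ (\<phi> + u))" (is "_ = ?D")
proof -
  have meas: "(\<lambda>u. circ (\<phi> + u)) \<in> restrict_space lborel {-pi..<pi} \<rightarrow>\<^sub>M S1_borel"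
    by (rule measurable_restrict_space1) simp
  have "hausdorff1_outer A = emeasure ?D A" if A: "A \<in> sets S1_borel" for A
  proof -
    have "emeasure ?D A = emeasure (restrict_space lborel {-pi..<pi}) {u \<in> {-pi..<pi}. circ (\<phi> + u) \<in> A}"
      by (subst emeasure_distr[OF meas A]) (simp add: space_restrict_space vimage_def Int_def conj_commute)
    also have "\<dots> = emeasure lborel {u \<in> {-pi..<pi}. circ (\<phi> + u) \<in> A}"
      by (rule emeasure_restrict_space) auto
    finally show ?thesis
      using hausdorff1_outer_le[OF A, of \<phi>] hausdorff1_outer_ge[of \<phi> A] by (simp add: antisym)
  qed
  then have "S1_hausdorff1 = measure_of (space ?D) (sets ?D) (emeasure ?D)"
    unfolding S1_hausdorff1_def using sets.space_closed[of S1_borel]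
    by (simp, intro measure_of_eq) (auto simp: sets.sigma_sets_eq[of S1_borel, simplified])
  then show ?thesis unfolding measure_of_of_measure .
qed

lemma sets_S1_hausdorff1 [simp, measurable_cong]: "sets S1_hausdorff1 = sets S1_borel"
  by (subst S1_hausdorff1_eq_distr[of 0]) simp

lemma nn_integral_S1_hausdorff1:
  assumes f: "f \<in> borel_measurable S1_borel"
  shows "integral\<^sup>N S1_hausdorff1 f = (\<integral>\<^sup>+u. f (circ (\<phi> + u)) * indicator {-pi..<pi} u \<partial>lborel)"
proof -
  have "integral\<^sup>N S1_hausdorff1 f = (\<integral>\<^sup>+u. f (circ (\<phi> + u)) \<partial>restrict_space lborel {-pi..<pi})"
    unfolding S1_hausdorff1_eq_distr[of \<phi>]
    by (rule nn_integral_distr) (use f in \<open>auto intro!: measurable_restrict_space1\<close>)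
  then show ?thesis by (simp add: nn_integral_restrict_space)
qed

section \<open>Antipodal invariance from a constant distance potential\<close>

text \<open>The half-open semicircle of angles in \<open>[\<theta>, \<theta> + \<pi>)\<close>.\<close>

definition semicircle :: "real \<Rightarrow> (real^3) set" where
  "semicircle \<theta> = {x \<in> S1. 0 < x \<bullet> circ (\<theta> + pi / 2) \<or> x = circ \<theta>}"

lemma circ_mem_semicircle_iff:
  assumes "\<theta> - pi \<le> s" "s < \<theta> + pi"
  shows "circ s \<in> semicircle \<theta> \<longleftrightarrow> \<theta> \<le> s"
proof -
  have "cos (s - (\<theta> + pi / 2)) = sin (s - \<theta>)"
    using cos_diff[of "s - \<theta>" "pi / 2"] by (simp add: algebra_simps)
  then have "circ s \<in> semicircle \<theta> \<longleftrightarrow> 0 < sin (s - \<theta>) \<or> circ s = circ \<theta>"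
    by (simp add: semicircle_def inner_circ)
  moreover consider "s < \<theta>" | "s = \<theta>" | "\<theta> < s" by linarith
  then have "0 < sin (s - \<theta>) \<or> circ s = circ \<theta> \<longleftrightarrow> \<theta> \<le> s"
  proof cases
    case 1
    have "sin (\<theta> - s) \<ge> 0" using assms 1 by (intro sin_ge_zero) auto
    then have "sin (s - \<theta>) \<le> 0" using sin_minus[of "\<theta> - s"] by simp
    moreover have "sph_dist (circ s) (circ \<theta>) = \<theta> - s"
      using 1 assms by (subst sph_dist_circ_abs) auto
    then have "circ s \<noteq> circ \<theta>" using 1 sph_dist_circ_abs[of \<theta> \<theta>] by auto
    ultimately show ?thesis using 1 by auto
  next
    case 3
    then have "0 < sin (s - \<theta>)" using assms by (intro sin_gt_zero) auto
    then show ?thesis using 3 by auto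
  qed auto
  ultimately show ?thesis by simp
qed

text \<open>The half-open form matters: of the two antipodal endpoints exactly one belongs to the
  semicircle.\<close>

lemma uminus_mem_semicircle_iff:
  assumes "x \<in> S1"
  shows "- x \<in> semicircle \<theta> \<longleftrightarrow> x \<notin> semicircle \<theta>"
proof -
  obtain s where s: "\<theta> - pi \<le> s" "s < \<theta> - pi + 2 * pi" "x = circ s"
    using assms by (rule S1_E)
  show ?thesis
  proof (cases "\<theta> \<le> s")
    case True
    then show ?thesis
      using s circ_mem_semicircle_iff[of \<theta> s] circ_mem_semicircle_iff[of \<theta> "s - pi"]
      by (simp add: circ_minus_pi)
  next
    case False
    then show ?thesis
      using s circ_mem_semicircle_iff[of \<theta> s] circ_mem_semicircle_iff[of \<theta> "s + pi"]
      by (simp add: circ_plus_pi)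
  qed
qed

lemma sets_semicircle [measurable]: "semicircle \<theta> \<in> sets S1_borel"
proof -
  have "semicircle \<theta> = S1 \<inter> ({x. 0 < x \<bullet> circ (\<theta> + pi / 2)} \<union> {circ \<theta>})"
    by (auto simp: semicircle_def)
  moreover have "open {x. 0 < x \<bullet> circ (\<theta> + pi / 2)}"
    by (intro open_Collect_less continuous_intros)
  ultimately have "semicircle \<theta> \<in> sets borel"
    using closed_S1 by (auto intro!: sets.Int sets.Un)
  then show ?thesis by (auto simp: sets_S1_borel_iff semicircle_def)
qed

text \<open>As the base point moves backwards from \<open>circ \<theta>\<close>, its distance to \<open>x\<close> changes at unit rate,
  increasing precisely for \<open>x\<close> in the semicircle ahead.\<close>

lemma sph_dist_difference_quotient:
  fixes x \<theta> defines "q \<equiv> \<lambda>n. (sph_dist x (circ (\<theta> - 1 / real (Suc n))) - sph_dist x (circ \<theta>)) * real (Suc n)"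
  assumes x: "x \<in> S1"
  shows "q \<longlonglongrightarrow> (if x \<in> semicircle \<theta> then 1 else -1)" "\<bar>q n\<bar> \<le> 1"
proof -
  obtain s where s: "\<theta> - pi \<le> s" "s < \<theta> - pi + 2 * pi" "x = circ s"
    using x by (rule S1_E)
  have d: "sph_dist x (circ \<theta>) = \<bar>s - \<theta>\<bar>"
    using s by (auto simp: sph_dist_circ_abs)
  have d1: "sph_dist x (circ (\<theta> - \<epsilon>)) = \<bar>s - \<theta> + \<epsilon>\<bar>" if "0 \<le> \<epsilon>" "\<epsilon> \<le> 1" "s - \<theta> + \<epsilon> \<le> pi" for \<epsilon>
    using that s sph_dist_circ_abs[of s "\<theta> - \<epsilon>"] by (auto simp: algebra_simps)
  \<comment> \<open>Once the base point has moved past the antipode of \<open>x\<close>, the shorter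
    arc is the one on the other side.\<close>
  have d2: "sph_dist x (circ (\<theta> - \<epsilon>)) = 2 * pi - (s - \<theta> + \<epsilon>)"
    if "0 \<le> \<epsilon>" "\<epsilon> \<le> 1" "pi \<le> s - \<theta> + \<epsilon>" for \<epsilon>
  proof -
    have "cos (s - (\<theta> - \<epsilon>)) = cos (2 * pi - (s - \<theta> + \<epsilon>))"
      using cos_diff[of "2 * pi" "s - \<theta> + \<epsilon>"] by (simp add: algebra_simps)
    then show ?thesis
      using that s pi_gt3 unfolding s(3) sph_dist_circ by (simp only:) (rule arccos_cos; simp)
  qed
  have e: "0 < 1 / real (Suc n)" "1 / real (Suc n) \<le> 1" for n by auto
  have "\<bar>sph_dist x (circ (\<theta> - 1 / real (Suc n))) - sph_dist x (circ \<theta>)\<bar> \<le> 1 / real (Suc n)"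
  proof (cases "s - \<theta> + 1 / real (Suc n) \<le> pi")
    case True
    then have "sph_dist x (circ (\<theta> - 1 / real (Suc n))) = \<bar>s - \<theta> + 1 / real (Suc n)\<bar>"
      by (rule d1[OF less_imp_le[OF e(1)] e(2)])
    then show ?thesis using e(1)[of n] unfolding d by arith
  next
    case False
    then have "sph_dist x (circ (\<theta> - 1 / real (Suc n))) = 2 * pi - (s - \<theta> + 1 / real (Suc n))"
      by (intro d2[OF less_imp_le[OF e(1)] e(2)]) simp
    then show ?thesis using e[of n] s(2) False pi_gt3 unfolding d by arith
  qed
  then have "\<bar>sph_dist x (circ (\<theta> - 1 / real (Suc n))) - sph_dist x (circ \<theta>)\<bar> * real (Suc n) \<le> 1"
    by (simp add: field_simps)
  then show "\<bar>q n\<bar> \<le> 1" by (simp add: q_def abs_mult)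
  have lim: "(\<lambda>n. 1 / real (Suc n)) \<longlonglongrightarrow> 0" by (rule LIMSEQ_Suc[OF lim_1_over_n])
  \<comment> \<open>For small steps the quotient is constant, since \<open>s\<close> stays strictly
    below \<open>\<theta> + pi\<close>. At \<open>s = \<theta>\<close> moving backwards increases
    the distance, which matches the endpoint \<open>circ \<theta>\<close> being in the
    semicircle.\<close>
  show "q \<longlonglongrightarrow> (if x \<in> semicircle \<theta> then 1 else -1)"
  proof (cases "\<theta> \<le> s")
    case True
    then have "x \<in> semicircle \<theta>" using s circ_mem_semicircle_iff[of \<theta> s] by simp
    have "\<forall>\<^sub>F n in sequentially. 1 / real (Suc n) < pi - (s - \<theta>)"
      using lim s by (intro order_tendstoD) auto
    then have "\<forall>\<^sub>F n in sequentially. q n = 1"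
    proof eventually_elim
      case (elim n)
      have "sph_dist x (circ (\<theta> - 1 / real (Suc n))) - sph_dist x (circ \<theta>) = 1 / real (Suc n)"
        using d1[of "1 / real (Suc n)"] elim e[of n] True by (simp add: d del: of_nat_Suc)
      then show ?case by (simp add: q_def del: of_nat_Suc)
    qed
    then show ?thesis using \<open>x \<in> semicircle \<theta>\<close> by (simp add: tendsto_eventually)
  next
    case False
    then have "x \<notin> semicircle \<theta>" using s circ_mem_semicircle_iff[of \<theta> s] by simp
    have "\<forall>\<^sub>F n in sequentially. 1 / real (Suc n) < \<theta> - s"
      using lim False by (intro order_tendstoD) auto
    then have "\<forall>\<^sub>F n in sequentially. q n = -1"
    proof eventually_elim
      case (elim n)
      have "sph_dist x (circ (\<theta> - 1 / real (Suc n))) - sph_dist x (circ \<theta>) = - (1 / real (Suc n))"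
        using d1[of "1 / real (Suc n)"] elim e[of n] pi_gt3 False by (simp add: d del: of_nat_Suc)
      then show ?case by (simp add: q_def del: of_nat_Suc)
    qed
    then show ?thesis using \<open>x \<notin> semicircle \<theta>\<close> by (simp add: tendsto_eventually)
  qed
qed

text \<open>On the circle this is the inverse of \<open>circ\<close> with values in [-pi, pi).
  Writing it through a semicircle and a distance makes its measurability immediate.\<close>

definition angle :: "real^3 \<Rightarrow> real" where
  "angle x = (if x \<in> semicircle 0 then sph_dist x (circ 0) else - sph_dist x (circ 0))"

lemma angle_circ: "-pi \<le> s \<Longrightarrow> s < pi \<Longrightarrow> angle (circ s) = s"
  using circ_mem_semicircle_iff[of 0 s] by (auto simp: angle_def sph_dist_circ_abs)

lemma circ_angle: "x \<in> S1 \<Longrightarrow> circ (angle x) = x"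
  by (rule S1_E[of x "-pi"]) (auto simp: angle_circ)

lemma measurable_angle: "angle \<in> borel_measurable S1_borel"
proof -
  have [measurable]: "(\<lambda>x. sph_dist x (circ 0)) \<in> borel_measurable S1_borel"
    by (rule measurable_sph_dist) auto
  show ?thesis unfolding angle_def by measurable
qed

text \<open>Expresses the arcs that start at angle \<open>-pi\<close> through semicircles, the sets
  whose masses are known. The split at \<open>s = 0\<close> separates arcs of at most half a turn
  from longer ones.\<close>

lemma angle_less_iff:
  assumes "x \<in> S1" "-pi < s" "s < pi"
  shows "angle x < s \<longleftrightarrow>
    (if s \<le> 0 then x \<notin> semicircle 0 \<and> x \<notin> semicircle s else x \<notin> semicircle 0 \<or> x \<notin> semicircle s)"
proof -
  obtain u where u: "-pi \<le> u" "u < -pi + 2 * pi" "x = circ u"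
    using assms(1) by (rule S1_E)
  then have "angle x = u" by (simp add: angle_circ)
  moreover have "x \<in> semicircle 0 \<longleftrightarrow> 0 \<le> u" using u circ_mem_semicircle_iff[of 0 u] by simp
  \<comment> \<open>The condition places \<open>u\<close> within \<open>pi\<close> of
    \<open>s\<close>, where membership is decided by order. In the remaining cases
    \<open>semicircle 0\<close> alone settles the claim.\<close>
  moreover have "x \<in> semicircle s \<longleftrightarrow> s \<le> u" if "s \<le> 0 \<longleftrightarrow> u < 0"
    using u that assms circ_mem_semicircle_iff[of s u] by auto
  ultimately show ?thesis by auto
qed

text \<open>The half-lines are an intersection-stable generator of the Borel sets of the line, so
  the images under \<open>angle\<close> coincide. As \<open>circ\<close> undoes \<open>angle\<close>
  on the circle, the equality carries back.\<close>

lemma finite_measure_eq_via_angle: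
  assumes \<sigma>: "finite_measure \<sigma>" "sets \<sigma> = sets S1_borel"
    and \<tau>: "finite_measure \<tau>" "sets \<tau> = sets S1_borel"
    and eq: "\<And>s. emeasure \<sigma> {x \<in> S1. angle x < s} = emeasure \<tau> {x \<in> S1. angle x < s}"
  shows "\<sigma> = \<tau>"
proof -
  have space: "space \<sigma> = S1" "space \<tau> = S1"
    using sets_eq_imp_space_eq[OF \<sigma>(2)] sets_eq_imp_space_eq[OF \<tau>(2)] by simp_all
  have ms: "angle \<in> borel_measurable \<sigma>" "angle \<in> borel_measurable \<tau>"
    using measurable_angle measurable_cong_sets[OF \<sigma>(2) refl] measurable_cong_sets[OF \<tau>(2) refl]
    by blast+
  have lessThan: "emeasure (distr \<sigma> borel angle) {..<s} = emeasure (distr \<tau> borel angle) {..<s}" for s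
    using eq[of s] by (simp add: emeasure_distr ms space vimage_def Int_def conj_commute)
  have lift: "distr \<sigma> borel angle = distr \<tau> borel angle"
  proof (rule measure_eqI_generator_eq[where \<Omega>=UNIV and E="range lessThan" and A="\<lambda>i. {..<real i}"])
    show "Int_stable (range lessThan :: real set set)"
      unfolding Int_stable_def
    proof (intro ballI)
      fix A B :: "real set" assume "A \<in> range lessThan" "B \<in> range lessThan"
      then obtain a b where "A = {..<a}" "B = {..<b}" by blast
      then have "A \<inter> B = {..<min a b}" by auto
      then show "A \<inter> B \<in> range lessThan" by blast
    qed
    show "(\<Union>i. {..<real i}) = UNIV" using reals_Archimedean2 by auto
    show "emeasure (distr \<sigma> borel angle) {..<real i} \<noteq> \<infinity>" for i
      using finite_measure.emeasure_finite[OF \<sigma>(1)] by (simp add: emeasure_distr ms)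
    show "sets (distr \<sigma> borel angle) = sigma_sets UNIV (range lessThan)"
      "sets (distr \<tau> borel angle) = sigma_sets UNIV (range lessThan)"
      by (simp_all add: borel_Iio)
  qed (use lessThan in auto)
  have "emeasure M A = emeasure (distr M borel angle) (circ -` A)"
    if "A \<in> sets S1_borel" "space M = S1" "angle \<in> borel_measurable M" for M A
  proof -
    have "circ -` A \<inter> space borel \<in> sets borel" using measurable_circ that(1) by (rule measurable_sets)
    moreover have "angle -` (circ -` A) \<inter> space M = A"
      using that by (auto simp: circ_angle sets_S1_borel_iff)
    ultimately show ?thesis using that by (simp add: emeasure_distr)
  qed
  then show ?thesis
    using \<sigma>(2) \<tau>(2) space ms lift by (intro measure_eqI) simp_all
qed

text \<open>The difference quotients of a constant potential integrate to 0. They are bounded by 1,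
  so by dominated convergence their limit, 1 on the semicircle and -1 off it, also integrates to
  0.\<close>

lemma measure_semicircle_compl:
  assumes "finite_measure M" and sets_M: "sets M = sets S1_borel"
    and C: "\<And>Q. Q \<in> S1 \<Longrightarrow> (\<integral>\<^sup>+x. ennreal (sph_dist x Q) \<partial>M) = C"
  shows "measure M (S1 - semicircle \<theta>) = measure M (semicircle \<theta>)"
proof -
  interpret finite_measure M by fact
  have space_M: "space M = S1" using sets_eq_imp_space_eq[OF sets_M] by simp
  note meas = measurable_sph_dist[OF _ sets_M]
  have int: "integrable M (\<lambda>x. sph_dist x Q)" if "Q \<in> S1" for Q
    by (rule integrable_const_bound[of _ pi])
       (use that meas in \<open>auto simp: space_M sph_dist_S1_nonneg sph_dist_S1_le_pi\<close>)
  have eq: "(\<integral>x. sph_dist x Q \<partial>M) = enn2real C" if "Q \<in> S1" for Q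
    using that C meas by (subst integral_eq_nn_integral) (auto simp: space_M sph_dist_S1_nonneg)
  define q where "q n x = (sph_dist x (circ (\<theta> - 1 / real (Suc n))) - sph_dist x (circ \<theta>)) * real (Suc n)" for n x
  have [measurable]: "semicircle \<theta> \<in> sets M" using sets_M by simp
  let ?g = "\<lambda>x. 2 * indicator (semicircle \<theta>) x - 1 :: real"
  have "(\<lambda>n. \<integral>x. q n x \<partial>M) \<longlonglongrightarrow> (\<integral>x. ?g x \<partial>M)"
  proof (rule integral_dominated_convergence[where w="\<lambda>_. 1"])
    show "AE x in M. (\<lambda>n. q n x) \<longlonglongrightarrow> ?g x"
    proof (rule AE_I2)
      fix x assume "x \<in> space M"
      then show "(\<lambda>n. q n x) \<longlonglongrightarrow> ?g x"
        using sph_dist_difference_quotient(1)[of x \<theta>] by (auto simp: q_def space_M indicator_def)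
    qed
    show "AE x in M. norm (q n x) \<le> 1" for n
      using sph_dist_difference_quotient(2)[of _ \<theta> n] by (auto simp: q_def space_M)
    show "q n \<in> borel_measurable M" for n
      unfolding q_def by (intro borel_measurable_times borel_measurable_diff meas borel_measurable_const) auto
  qed auto
  moreover have "(\<integral>x. q n x \<partial>M) = 0" for n
    unfolding q_def using int eq by (simp del: of_nat_Suc)
  ultimately have "(\<integral>x. ?g x \<partial>M) = 0" by (simp add: LIMSEQ_const_iff)
  moreover have "(\<integral>x. ?g x \<partial>M) = 2 * measure M (semicircle \<theta>) - measure M S1"
    by (subst Bochner_Integration.integral_diff)
      (auto simp: space_M[symmetric] less_top[symmetric])
  moreover have "measure M (S1 - semicircle \<theta>) = measure M S1 - measure M (semicircle \<theta>)"
  proof (rule finite_measure_Diff)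
    show "S1 \<in> sets M" using sets.top[of M] by (simp add: space_M)
    show "semicircle \<theta> \<subseteq> S1" by (auto simp: semicircle_def)
  qed simp
  ultimately show ?thesis by simp
qed

text \<open>All semicircles carry half the mass. By inclusion-exclusion the intersection of two of
  them then has the mass of the complement of their union, and the antipodal map exchanges these two
  sets. Hence \<open>\<sigma>\<close> and its image agree on the arcs that determine a
  measure.\<close>

lemma antipodal_invariant_if_constant_distance:
  assumes "finite_measure \<sigma>" and sets_\<sigma>: "sets \<sigma> = sets S1_borel"
    and C: "\<And>Q. Q \<in> S1 \<Longrightarrow> (\<integral>\<^sup>+x. ennreal (sph_dist x Q) \<partial>\<sigma>) = C"
  shows "distr \<sigma> S1_borel uminus = \<sigma>"
proof -
  interpret finite_measure \<sigma> by fact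
  let ?\<tau> = "distr \<sigma> S1_borel uminus"
  let ?R = semicircle
  have space: "space \<sigma> = S1" using sets_eq_imp_space_eq[OF sets_\<sigma>] by simp
  note um = measurable_uminus_S1[OF sets_\<sigma>]
  interpret \<tau>: finite_measure ?\<tau>
    using um by (rule finite_measure_distr)
  have R [simp]: "?R \<theta> \<in> sets \<sigma>" "S1 \<in> sets \<sigma>" for \<theta>
    using sets_\<sigma> sets.top[of S1_borel] by simp_all
  have R_subset: "?R \<theta> \<subseteq> S1" for \<theta> by (auto simp: semicircle_def)
  have \<tau>: "measure ?\<tau> A = measure \<sigma> {x \<in> S1. - x \<in> A}" if "A \<in> sets \<sigma>" for A
    using that um sets_\<sigma> by (simp add: measure_distr space vimage_def Int_def conj_commute)
  have half: "measure \<sigma> (?R \<theta>) = measure \<sigma> S1 / 2" for \<theta>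
    using measure_semicircle_compl[OF assms(1) sets_\<sigma> C, of \<theta>] finite_measure_Diff[of S1 "?R \<theta>"] R_subset by simp
  have compl: "measure \<sigma> (S1 - (?R a \<union> ?R b)) = measure \<sigma> (?R a \<inter> ?R b)" for a b
  proof -
    have "measure \<sigma> (?R a \<union> ?R b) = measure \<sigma> S1 - measure \<sigma> (?R a \<inter> ?R b)"
      using measure_Un3[of "?R a" \<sigma> "?R b"] by (simp add: fmeasurable_eq_sets half)
    then show ?thesis
      using finite_measure_Diff[of S1 "?R a \<union> ?R b"] R_subset sets.Un[OF R(1) R(1)] by simp
  qed
  have [simp]: "S1 - ?R a \<inter> ?R b \<in> sets \<sigma>" "S1 - (?R a \<union> ?R b) \<in> sets \<sigma>" for a b
    by (intro sets.Diff sets.Int sets.Un R)+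
  have inter: "measure ?\<tau> (S1 - (?R a \<inter> ?R b)) = measure \<sigma> (S1 - (?R a \<inter> ?R b))" for a b
  proof -
    have "measure ?\<tau> (S1 - (?R a \<inter> ?R b)) = measure \<sigma> (?R a \<union> ?R b)"
      by (subst \<tau>) (auto simp: uminus_mem_semicircle_iff R_subset[THEN subsetD] intro!: arg_cong[where f="measure \<sigma>"])
    also have "\<dots> = measure \<sigma> S1 - measure \<sigma> (?R a \<inter> ?R b)"
      using measure_Un3[of "?R a" \<sigma> "?R b"] by (simp add: fmeasurable_eq_sets half)
    also have "\<dots> = measure \<sigma> (S1 - (?R a \<inter> ?R b))"
      using R_subset sets.Int[OF R(1) R(1)] by (subst finite_measure_Diff) auto
    finally show ?thesis .
  qed
  have union: "measure ?\<tau> (S1 - (?R a \<union> ?R b)) = measure \<sigma> (S1 - (?R a \<union> ?R b))" for a b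
    unfolding compl
    by (subst \<tau>) (auto simp: uminus_mem_semicircle_iff R_subset[THEN subsetD] intro!: arg_cong[where f="measure \<sigma>"])
  have "measure ?\<tau> {x \<in> S1. angle x < s} = measure \<sigma> {x \<in> S1. angle x < s}" for s
  proof -
    consider "s \<le> -pi" | "pi \<le> s" | "-pi < s" "s \<le> 0" | "0 < s" "s < pi" by linarith
    then show ?thesis
    proof cases
      case 1
      have "{x \<in> S1. angle x < s} = {}" using 1 by (force elim!: S1_E[of _ "-pi"] simp: angle_circ)
      then show ?thesis by (simp only: measure_empty)
    next
      case 2
      have "{x \<in> S1. angle x < s} = S1" using 2 by (force elim!: S1_E[of _ "-pi"] simp: angle_circ)
      then show ?thesis by (simp only: \<tau>[OF R(2)] uminus_S1 Collect_conj_eq Int_absorb Collect_mem_eq)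
    next
      case 3
      then have "{x \<in> S1. angle x < s} = S1 - (?R 0 \<union> ?R s)" by (auto simp: angle_less_iff)
      then show ?thesis by (simp only: union)
    next
      case 4
      then have "{x \<in> S1. angle x < s} = S1 - (?R 0 \<inter> ?R s)" by (auto simp: angle_less_iff)
      then show ?thesis by (simp only: inter)
    qed
  qed
  then show ?thesis
    using \<open>finite_measure \<sigma>\<close> \<tau>.finite_measure_axioms sets_\<sigma>
    by (intro finite_measure_eq_via_angle) (simp_all add: emeasure_eq_measure \<tau>.emeasure_eq_measure)
qed

section \<open>The density\<close>

lemma nn_integral_indicator_eq_has_integral:
  fixes g :: "real \<Rightarrow> real"
  assumes "g \<in> borel_measurable borel" "S \<in> sets borel"
    and "\<And>u. u \<in> S \<Longrightarrow> 0 \<le> g u" "(g has_integral I) S"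
  shows "(\<integral>\<^sup>+u. ennreal (g u) * indicator S u \<partial>lborel) = ennreal I"
proof -
  have "(\<integral>\<^sup>+u. ennreal (g u) * indicator S u \<partial>lborel) = (\<integral>\<^sup>+u. ennreal (if u \<in> S then g u else 0) \<partial>lborel)"
    by (rule nn_integral_cong) (simp add: indicator_def)
  also have "\<dots> = ennreal I"
    by (rule nn_integral_has_integral_lborel) (use assms in \<open>auto simp: has_integral_restrict_UNIV\<close>)
  finally show ?thesis .
qed

section \<open>Calculus of the function \<open>arccos (r * cos u)\<close>\<close>

lemma one_minus_rcos_pos:
  fixes r u :: real
  assumes "0 \<le> r" "r < 1"
  shows "\<bar>r * cos u\<bar> < 1" "0 < 1 - (r * cos u)\<^sup>2"
proof -
  have "\<bar>r * cos u\<bar> \<le> r" using assms by (simp add: abs_mult mult_left_le)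
  then show *: "\<bar>r * cos u\<bar> < 1" using assms by simp
  show "0 < 1 - (r * cos u)\<^sup>2" using * by (simp add: abs_square_less_1)
qed

text \<open>Half of the second derivative of \<open>\<lambda>u. arccos (r * cos u)\<close>.\<close>

definition kernel :: "real \<Rightarrow> real \<Rightarrow> real" where
  "kernel r u = (1 - r\<^sup>2) * (r * cos u) / (2 * sqrt (1 - (r * cos u)\<^sup>2) ^ 3)"

lemma measurable_kernel [measurable]: "kernel r \<in> borel_measurable borel"
  unfolding kernel_def by measurable

lemma kernel_nonneg:
  assumes "0 \<le> r" "r < 1" "u \<in> {-(pi/2)..pi/2}"
  shows "0 \<le> kernel r u"
  unfolding kernel_def using assms one_minus_rcos_pos[of r u]
  by (auto intro!: divide_nonneg_nonneg mult_nonneg_nonneg cos_ge_zero simp: abs_square_le_1)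

lemma DERIV_arccos_rcos:
  assumes "0 \<le> r" "r < 1"
  shows "((\<lambda>u. arccos (r * cos u)) has_real_derivative r * sin u / sqrt (1 - (r * cos u)\<^sup>2)) (at u within X)"
proof -
  have "-1 < r * cos u" "r * cos u < 1" using one_minus_rcos_pos(1)[OF assms, of u] by linarith+
  then show ?thesis
    by (auto intro!: derivative_eq_intros simp: field_simps)
qed

lemma DERIV_arccos_rcos_2:
  assumes "0 \<le> r" "r < 1"
  shows "((\<lambda>u. r * sin u / sqrt (1 - (r * cos u)\<^sup>2)) has_real_derivative 2 * kernel r u) (at u within X)"
proof -
  define s where "s = sqrt (1 - (r * cos u)\<^sup>2)"
  have "0 < s" "s\<^sup>2 = 1 - (r * cos u)\<^sup>2"
    using one_minus_rcos_pos(2)[OF assms, of u] by (simp_all add: s_def)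
  have "((\<lambda>u. r * sin u / sqrt (1 - (r * cos u)\<^sup>2)) has_real_derivative
      (r * cos u * s - r * sin u * (r * cos u * (r * sin u) / s)) / (s * s)) (at u within X)"
    using one_minus_rcos_pos(2)[OF assms, of u]
    by (auto intro!: derivative_eq_intros simp: s_def field_simps power2_eq_square)
  also have "(r * cos u * s - r * sin u * (r * cos u * (r * sin u) / s)) / (s * s)
      = r * cos u * (s\<^sup>2 - (r * sin u)\<^sup>2) / s ^ 3"
    using \<open>0 < s\<close> by (simp add: field_simps power2_eq_square power3_eq_cube)
  also have "s\<^sup>2 - (r * sin u)\<^sup>2 = 1 - r\<^sup>2"
    unfolding \<open>s\<^sup>2 = _\<close> by (simp add: power_mult_distrib cos_squared_eq algebra_simps)
  also have "r * cos u * (1 - r\<^sup>2) / s ^ 3 = 2 * kernel r u"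
    by (simp add: kernel_def s_def)
  finally show ?thesis .
qed

text \<open>The first derivative of \<open>arccos (r * cos u)\<close> rises from \<open>-r\<close>
  to \<open>r\<close> across the semicircle, and the kernel is half of the second. This is where the
  constant \<open>k = r\<close> comes from.\<close>

lemma kernel_has_integral:
  assumes r: "0 \<le> r" "r < 1"
  shows "(kernel r has_integral r) {-(pi/2)..pi/2}"
proof -
  have "((\<lambda>u. 2 * kernel r u) has_integral
      r * sin (pi/2) / sqrt (1 - (r * cos (pi/2))\<^sup>2) - r * sin (-(pi/2)) / sqrt (1 - (r * cos (-(pi/2)))\<^sup>2)) {-(pi/2)..pi/2}"
    using DERIV_arccos_rcos_2[OF r]
    by (intro fundamental_theorem_of_calculus) (simp_all add: has_real_derivative_iff_has_vector_derivative)
  from has_integral_mult_right[OF this, of "1/2"] show ?thesis by simp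
qed

text \<open>Integration by parts: with \<open>f u = arccos (r * cos u)\<close>, the function
  \<open>(f' u * (u - v) - f u) / 2\<close> is an antiderivative of
  \<open>kernel r u * (u - v)\<close>. Splitting at \<open>v\<close>, where the absolute value
  changes sign, produces \<open>f v\<close>; the endpoints contribute the constant.\<close>

lemma kernel_abs_has_integral:
  assumes r: "0 \<le> r" "r < 1" and v: "v \<in> {-(pi/2)..pi/2}"
  shows "((\<lambda>u. kernel r u * \<bar>u - v\<bar>) has_integral arccos (r * cos v) - (1 - r) * (pi / 2)) {-(pi/2)..pi/2}"
proof -
  define F where "F u = (r * sin u / sqrt (1 - (r * cos u)\<^sup>2) * (u - v) - arccos (r * cos u)) / 2" for u
  have F: "(F has_vector_derivative kernel r u * (u - v)) (at u within X)" for u X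
  proof -
    have "((\<lambda>u. u - v) has_real_derivative 1) (at u within X)"
      by (auto intro!: derivative_eq_intros)
    then have "(F has_real_derivative (2 * kernel r u * (u - v) + 1 * (r * sin u / sqrt (1 - (r * cos u)\<^sup>2))
        - r * sin u / sqrt (1 - (r * cos u)\<^sup>2)) / 2) (at u within X)"
      unfolding F_def
      by (intro DERIV_cdivide DERIV_diff DERIV_mult DERIV_arccos_rcos[OF r] DERIV_arccos_rcos_2[OF r])
    then show ?thesis by (simp add: has_real_derivative_iff_has_vector_derivative)
  qed
  have "((\<lambda>u. kernel r u * (u - v)) has_integral F v - F (-(pi/2))) {-(pi/2)..v}"
    using v F by (intro fundamental_theorem_of_calculus) auto
  from has_integral_neg[OF this]
  have 1: "((\<lambda>u. kernel r u * \<bar>u - v\<bar>) has_integral - (F v - F (-(pi/2)))) {-(pi/2)..v}"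
    by (rule has_integral_eq[rotated]) (auto simp: algebra_simps)
  have "((\<lambda>u. kernel r u * (u - v)) has_integral F (pi/2) - F v) {v..pi/2}"
    using v F by (intro fundamental_theorem_of_calculus) auto
  then have 2: "((\<lambda>u. kernel r u * \<bar>u - v\<bar>) has_integral F (pi/2) - F v) {v..pi/2}"
    by (rule has_integral_eq[rotated]) auto
  have "- (F v - F (-(pi/2))) + (F (pi/2) - F v) = arccos (r * cos v) - (1 - r) * (pi / 2)"
    by (simp add: F_def arccos_0 field_simps)
  then show ?thesis using has_integral_combine[OF _ _ 1 2] v by simp
qed

text \<open>Polar coordinates of the projection of \<open>P\<close> to the plane of the circle. For
  a unit vector \<open>P\<close>, the bound \<open>r < 1\<close> says that \<open>P\<close> is off
  the circle; for \<open>r = 0\<close> the angle is arbitrary.\<close>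

locale interior_point =
  fixes P :: "real^3" and r \<phi> :: real
  assumes r_nonneg: "0 \<le> r" and r_less_1: "r < 1"
    and P_nth: "P $ 1 = r * cos \<phi>" "P $ 2 = r * sin \<phi>"
begin

text \<open>The positive part of \<open>kernel r\<close> in coordinate-free form, with
  \<open>P \<bullet> x\<close> for \<open>r * cos u\<close>, so that continuity can be read off
  without choosing angles.\<close>

definition dens :: "real^3 \<Rightarrow> real" where
  "dens x = max 0 ((1 - r\<^sup>2) * (P \<bullet> x) / (2 * sqrt (1 - (P \<bullet> x)\<^sup>2) ^ 3))"

definition base_measure :: "(real^3) measure" where
  "base_measure = density S1_hausdorff1 (\<lambda>x. ennreal (dens x))"

lemma inner_P_circ: "P \<bullet> circ (\<phi> + u) = r * cos u"
proof -
  have "P \<bullet> circ (\<phi> + u) = r * (cos (\<phi> + u) * cos \<phi> + sin (\<phi> + u) * sin \<phi>)"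
    by (simp add: inner_vec3 P_nth algebra_simps)
  also have "\<dots> = r * cos u" using cos_diff[of "\<phi> + u" \<phi>] by simp
  finally show ?thesis .
qed

lemma S1_E_shift:
  assumes "x \<in> S1"
  obtains u where "a \<le> u" "u < a + 2 * pi" "x = circ (\<phi> + u)"
proof -
  obtain t where "\<phi> + a \<le> t" "t < \<phi> + a + 2 * pi" "x = circ t" using assms by (rule S1_E)
  then show ?thesis using that[of "t - \<phi>"] by simp
qed

lemma inner_P_abs_less_1: "x \<in> S1 \<Longrightarrow> \<bar>P \<bullet> x\<bar> < 1"
  by (metis S1_E_shift inner_P_circ one_minus_rcos_pos(1) r_nonneg r_less_1)

lemma sph_dist_P_uminus: "x \<in> S1 \<Longrightarrow> sph_dist P (- x) = pi - sph_dist P x"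
  using inner_P_abs_less_1[of x] by (simp add: sph_dist_def arccos_minus)

lemma sph_dist_P_bounds: "x \<in> S1 \<Longrightarrow> 0 \<le> sph_dist P x \<and> sph_dist P x \<le> pi"
  using inner_P_abs_less_1[of x] by (simp add: sph_dist_def arccos_lbound arccos_ubound)

lemma dens_nonneg: "0 \<le> dens x"
  by (simp add: dens_def)

lemma dens_eq_0_iff: "x \<in> S1 \<Longrightarrow> dens x = 0 \<longleftrightarrow> P \<bullet> x \<le> 0"
proof -
  assume "x \<in> S1"
  then have "0 < 1 - (P \<bullet> x)\<^sup>2" using inner_P_abs_less_1 by (simp add: abs_square_less_1)
  have "0 < 1 - r\<^sup>2" using r_nonneg r_less_1 by (simp add: abs_square_less_1)
  define c where "c = (1 - r\<^sup>2) / (2 * sqrt (1 - (P \<bullet> x)\<^sup>2) ^ 3)"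
  have "0 < c" unfolding c_def using \<open>0 < 1 - (P \<bullet> x)\<^sup>2\<close> \<open>0 < 1 - r\<^sup>2\<close> by simp
  moreover have "dens x = max 0 (c * (P \<bullet> x))" by (simp add: dens_def c_def)
  ultimately show ?thesis by (auto simp: max_def mult_le_0_iff zero_le_mult_iff)
qed

lemma continuous_dens: "continuous_on S1 dens"
  unfolding dens_def
proof (intro continuous_intros ballI)
  fix x assume "x \<in> S1"
  then have "0 < 1 - (P \<bullet> x)\<^sup>2" using inner_P_abs_less_1 by (simp add: abs_square_less_1)
  then show "2 * sqrt (1 - (P \<bullet> x)\<^sup>2) ^ 3 \<noteq> 0" by simp
qed

lemma measurable_dens [measurable]: "dens \<in> borel_measurable S1_borel"
  unfolding S1_borel_def using continuous_dens by (rule borel_measurable_continuous_on_restrict)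

lemma dens_circ:
  assumes "u \<in> {-pi..<pi}"
  shows "dens (circ (\<phi> + u)) = (if u \<in> {-(pi/2)..pi/2} then kernel r u else 0)"
proof (cases "u \<in> {-(pi/2)..pi/2}")
  case True
  then show ?thesis
    using kernel_nonneg[OF r_nonneg r_less_1 True] by (simp add: dens_def inner_P_circ kernel_def)
next
  case False
  have "cos u \<le> 0"
  proof -
    have "cos (pi - \<bar>u\<bar>) \<ge> 0" using False assms by (intro cos_ge_zero) (auto simp: abs_if)
    moreover have "cos (pi - \<bar>u\<bar>) = - cos u" by (simp add: abs_if cos_diff)
    ultimately show ?thesis by simp
  qed
  then have "P \<bullet> circ (\<phi> + u) \<le> 0"
    using r_nonneg by (simp add: inner_P_circ mult_nonneg_nonpos)
  then show ?thesis using False dens_eq_0_iff[of "circ (\<phi> + u)"] by auto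
qed

lemma sets_base_measure [simp, measurable_cong]: "sets base_measure = sets S1_borel"
  by (simp add: base_measure_def)

lemma nn_integral_base_measure:
  assumes [measurable]: "f \<in> borel_measurable S1_borel"
  shows "integral\<^sup>N base_measure f
    = (\<integral>\<^sup>+u. ennreal (kernel r u) * f (circ (\<phi> + u)) * indicator {-(pi/2)..pi/2} u \<partial>lborel)"
proof -
  have "integral\<^sup>N base_measure f = (\<integral>\<^sup>+x. ennreal (dens x) * f x \<partial>S1_hausdorff1)"
    unfolding base_measure_def by (rule nn_integral_density) measurable
  also have "\<dots> = (\<integral>\<^sup>+u. ennreal (dens (circ (\<phi> + u))) * f (circ (\<phi> + u)) * indicator {-pi..<pi} u \<partial>lborel)"
    by (rule nn_integral_S1_hausdorff1) measurable
  also have "\<dots> = (\<integral>\<^sup>+u. ennreal (kernel r u) * f (circ (\<phi> + u)) * indicator {-(pi/2)..pi/2} u \<partial>lborel)"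
  proof (rule nn_integral_cong)
    fix u
    show "ennreal (dens (circ (\<phi> + u))) * f (circ (\<phi> + u)) * indicator {-pi..<pi} u
        = ennreal (kernel r u) * f (circ (\<phi> + u)) * indicator {-(pi/2)..pi/2} u"
    proof (cases "u \<in> {-pi..<pi}")
      case False
      then have "u \<notin> {-(pi/2)..pi/2}" using pi_gt_zero by (auto simp del: pi_gt_zero)
      then show ?thesis using False by simp
    qed (simp add: dens_circ)
  qed
  finally show ?thesis .
qed

section \<open>Mass and distance potential of the base measure\<close>

lemma emeasure_base_measure_S1: "emeasure base_measure S1 = ennreal r"
proof -
  have "emeasure base_measure S1 = integral\<^sup>N base_measure (\<lambda>_. 1)"
    using sets_eq_imp_space_eq[OF sets_base_measure] by simp
  also have "\<dots> = ennreal r"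
    by (subst nn_integral_base_measure, simp)
      (simp, intro nn_integral_indicator_eq_has_integral kernel_has_integral kernel_nonneg r_nonneg r_less_1; simp)
  finally show ?thesis .
qed

lemma finite_measure_base_measure: "finite_measure base_measure"
  using emeasure_base_measure_S1 sets_eq_imp_space_eq[OF sets_base_measure] by (intro finite_measureI) simp

text \<open>If \<open>Q\<close> lies on the semicircle centered at the projection of
  \<open>P\<close>, this is the kernel integral above. Otherwise \<open>-Q\<close> lies there, and
  \<open>d(x, Q) = pi - d(x, -Q)\<close> together with the total mass \<open>r\<close> reduces to
  that case. The second claim shows that \<open>ennreal\<close> does not truncate the
  difference.\<close>

lemma nn_integral_sph_dist_base_measure:
  assumes "Q \<in> S1"
  shows "(\<integral>\<^sup>+x. ennreal (sph_dist x Q) \<partial>base_measure) = ennreal (sph_dist P Q - (1 - r) * (pi / 2))"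
    and "(1 - r) * (pi / 2) \<le> sph_dist P Q"
proof -
  let ?I = "{-(pi/2)..pi/2}"
  \<comment> \<open>Here \<open>g\<close> is the distance to \<open>Q\<close> as a function of the
    angle; a real integral against the kernel then gives both claims at once.\<close>
  have key: "(\<integral>\<^sup>+x. ennreal (sph_dist x Q) \<partial>base_measure) = ennreal (sph_dist P Q - (1 - r) * (pi / 2)) \<and>
      (1 - r) * (pi / 2) \<le> sph_dist P Q"
    if g: "\<And>u. u \<in> ?I \<Longrightarrow> sph_dist (circ (\<phi> + u)) Q = g u" "g \<in> borel_measurable borel"
      and int: "((\<lambda>u. kernel r u * g u) has_integral sph_dist P Q - (1 - r) * (pi / 2)) ?I" for g
  proof -
    have g_nonneg: "0 \<le> g u" if "u \<in> ?I" for u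
      using g(1)[OF that] sph_dist_S1_nonneg[OF circ_in_S1 assms] by metis
    note nonneg = kernel_nonneg[OF r_nonneg r_less_1]
    have "(\<integral>\<^sup>+x. ennreal (sph_dist x Q) \<partial>base_measure)
        = (\<integral>\<^sup>+u. ennreal (kernel r u) * ennreal (sph_dist (circ (\<phi> + u)) Q) * indicator ?I u \<partial>lborel)"
      by (subst nn_integral_base_measure) (use measurable_sph_dist[OF assms] in auto)
    also have "\<dots> = (\<integral>\<^sup>+u. ennreal (kernel r u * g u) * indicator ?I u \<partial>lborel)"
      by (rule nn_integral_cong) (auto simp: indicator_def g ennreal_mult nonneg g_nonneg)
    also have "\<dots> = ennreal (sph_dist P Q - (1 - r) * (pi / 2))"
      using g(2) by (intro nn_integral_indicator_eq_has_integral int) (simp_all add: nonneg g_nonneg)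
    finally show ?thesis
      using has_integral_nonneg[OF int] by (simp add: nonneg g_nonneg)
  qed
  have "(\<integral>\<^sup>+x. ennreal (sph_dist x Q) \<partial>base_measure) = ennreal (sph_dist P Q - (1 - r) * (pi / 2)) \<and>
      (1 - r) * (pi / 2) \<le> sph_dist P Q"
  proof -
    obtain w where w: "-(pi/2) \<le> w" "w < -(pi/2) + 2 * pi" "Q = circ (\<phi> + w)"
      using assms by (rule S1_E_shift)
    show ?thesis
    proof (cases "w \<le> pi / 2")
      case True
      show ?thesis
      proof (rule key)
        show "sph_dist (circ (\<phi> + u)) Q = \<bar>u - w\<bar>" if "u \<in> ?I" for u
          using that True w by (subst w(3), subst sph_dist_circ_abs) auto
        show "((\<lambda>u. kernel r u * \<bar>u - w\<bar>) has_integral sph_dist P Q - (1 - r) * (pi / 2)) ?I"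
          using kernel_abs_has_integral[OF r_nonneg r_less_1, of w] w True
          by (simp add: sph_dist_def inner_P_circ)
      qed simp
    next
      case False
      define v where "v = w - pi"
      have v: "v \<in> ?I" using w False by (auto simp: v_def)
      have Q: "Q = - circ (\<phi> + v)" using w(3) circ_plus_pi[of "\<phi> + v"] by (simp add: v_def)
      show ?thesis
      proof (rule key)
        show "sph_dist (circ (\<phi> + u)) Q = pi - \<bar>u - v\<bar>" if "u \<in> ?I" for u
        proof -
          have "sph_dist (circ (\<phi> + u)) (circ (\<phi> + v)) = \<bar>u - v\<bar>"
            using that v by (subst sph_dist_circ_abs) auto
          then show ?thesis by (simp add: Q sph_dist_uminus_right)
        qed
        have "((\<lambda>u. pi * kernel r u - kernel r u * \<bar>u - v\<bar>) has_integral
            pi * r - (arccos (r * cos v) - (1 - r) * (pi / 2))) ?I"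
          by (intro has_integral_diff has_integral_mult_right kernel_has_integral kernel_abs_has_integral r_nonneg r_less_1 v)
        also have "pi * r - (arccos (r * cos v) - (1 - r) * (pi / 2)) = sph_dist P Q - (1 - r) * (pi / 2)"
        proof -
          have "sph_dist P Q = pi - arccos (r * cos v)"
            unfolding Q sph_dist_P_uminus[OF circ_in_S1] by (simp add: sph_dist_def inner_P_circ)
          then show ?thesis by (simp add: field_simps)
        qed
        finally show "((\<lambda>u. kernel r u * (pi - \<bar>u - v\<bar>)) has_integral sph_dist P Q - (1 - r) * (pi / 2)) ?I"
          by (simp only: right_diff_distrib mult.commute[of pi])
      qed simp
    qed
  qed
  then show "(\<integral>\<^sup>+x. ennreal (sph_dist x Q) \<partial>base_measure) = ennreal (sph_dist P Q - (1 - r) * (pi / 2))"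
    "(1 - r) * (pi / 2) \<le> sph_dist P Q" by blast+
qed

end

section \<open>The bijection\<close>

text \<open>The distances from \<open>x\<close> and \<open>-x\<close> to \<open>Q\<close> add up to
  \<open>pi\<close>, so by invariance twice the integral is \<open>pi\<close>.\<close>

lemma nn_integral_sph_dist_periodic:
  assumes \<nu>: "\<nu> \<in> S1_probs" "pi_periodic \<nu>" and Q: "Q \<in> S1"
  shows "(\<integral>\<^sup>+x. ennreal (sph_dist x Q) \<partial>\<nu>) = ennreal (pi / 2)"
proof -
  have sets_\<nu>: "sets \<nu> = sets S1_borel" and "prob_space \<nu>" using \<nu> by (auto simp: S1_probs_def)
  interpret prob_space \<nu> by fact
  have space: "space \<nu> = S1" using sets_eq_imp_space_eq[OF sets_\<nu>] by simp
  have [measurable]: "(\<lambda>x. sph_dist x Q) \<in> borel_measurable \<nu>" by (rule measurable_sph_dist[OF Q sets_\<nu>])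
  let ?I = "\<integral>\<^sup>+x. ennreal (sph_dist x Q) \<partial>\<nu>"
  have "?I = (\<integral>\<^sup>+x. ennreal (sph_dist x Q) \<partial>distr \<nu> S1_borel uminus)"
    using \<nu>(2) by (simp add: pi_periodic_def)
  also have "\<dots> = (\<integral>\<^sup>+x. ennreal (sph_dist (- x) Q) \<partial>\<nu>)"
    using measurable_uminus_S1[OF sets_\<nu>] measurable_sph_dist[OF Q] by (intro nn_integral_distr) auto
  also have "\<dots> = (\<integral>\<^sup>+x. ennreal (pi - sph_dist x Q) \<partial>\<nu>)"
    using Q by (intro nn_integral_cong) (simp add: space sph_dist_uminus_left)
  finally have "?I + ?I = ?I + (\<integral>\<^sup>+x. ennreal (pi - sph_dist x Q) \<partial>\<nu>)" by simp
  also have "\<dots> = (\<integral>\<^sup>+x. ennreal (sph_dist x Q) + ennreal (pi - sph_dist x Q) \<partial>\<nu>)"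
    by (rule nn_integral_add[symmetric]) auto
  also have "\<dots> = (\<integral>\<^sup>+x. ennreal pi \<partial>\<nu>)"
    using Q by (intro nn_integral_cong)
      (simp add: space sph_dist_S1_nonneg sph_dist_S1_le_pi flip: ennreal_plus)
  also have "\<dots> = ennreal pi" by (simp add: emeasure_space_1)
  finally have "?I + ?I = ennreal pi" .
  then show ?thesis
    by (cases ?I) (auto simp flip: ennreal_plus)
qed

lemma nn_integral_sph_dist_uminus:
  assumes sets: "sets M = sets S1_borel" and Q: "Q \<in> S1"
  shows "(\<integral>\<^sup>+x. ennreal (sph_dist x Q) \<partial>distr M S1_borel uminus) = (\<integral>\<^sup>+x. ennreal (sph_dist x (- Q)) \<partial>M)"
proof -
  have "(\<integral>\<^sup>+x. ennreal (sph_dist x Q) \<partial>distr M S1_borel uminus) = (\<integral>\<^sup>+x. ennreal (sph_dist (- x) Q) \<partial>M)"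
    using measurable_uminus_S1[OF sets] measurable_sph_dist[OF Q] by (intro nn_integral_distr) auto
  then show ?thesis by (simp add: sph_dist_def)
qed

lemma finite_measure_add_measure:
  assumes "finite_measure M" "finite_measure N" "sets N = sets M"
  shows "finite_measure (add_measure M N)"
proof (rule finite_measureI)
  show "emeasure (add_measure M N) (space (add_measure M N)) \<noteq> \<infinity>"
    using assms sets_eq_imp_space_eq[OF assms(3)] by (simp add: emeasure_add_measure finite_measure.emeasure_finite)
qed

context interior_point
begin

lemma Phi_dens: "Phi dens r \<nu> = add_measure base_measure (scale_measure (ennreal (1 - r)) \<nu>)"
  by (simp add: Phi_def base_measure_def)

lemma emeasure_Phi_dens:
  assumes "sets \<nu> = sets S1_borel" "A \<in> sets S1_borel"
  shows "emeasure (Phi dens r \<nu>) A = emeasure base_measure A + ennreal (1 - r) * emeasure \<nu> A"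
  using assms by (simp add: Phi_dens emeasure_add_measure)

text \<open>\<open>enn2real\<close> sends infinity to 0, so equality of extended integrals follows
  only once the integral is known to be finite; it is at most \<open>pi\<close>.\<close>

lemma wasserstein1_eq_sph_dist_P_iff:
  assumes \<mu>: "\<mu> \<in> S1_probs" and Q: "Q \<in> S1"
  shows "wasserstein1 \<mu> (return S1_borel Q) = sph_dist P Q
    \<longleftrightarrow> (\<integral>\<^sup>+x. ennreal (sph_dist x Q) \<partial>\<mu>) = ennreal (sph_dist P Q)"
proof -
  have sets_\<mu>: "sets \<mu> = sets S1_borel" and "prob_space \<mu>" using \<mu> by (auto simp: S1_probs_def)
  interpret prob_space \<mu> by fact
  have "(\<integral>\<^sup>+x. ennreal (sph_dist x Q) \<partial>\<mu>) \<le> (\<integral>\<^sup>+x. ennreal pi \<partial>\<mu>)"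
    using Q sets_eq_imp_space_eq[OF sets_\<mu>] by (intro nn_integral_mono ennreal_leI) (simp add: sph_dist_S1_le_pi)
  also have "\<dots> < \<top>" by (simp add: emeasure_space_1)
  finally show ?thesis
    using sph_dist_P_bounds[OF Q] ennreal_enn2real enn2real_ennreal
    unfolding wasserstein1_return[OF \<mu> Q] by metis
qed

lemma Phi_dens_in_S1_probs:
  assumes "\<nu> \<in> S1_probs"
  shows "Phi dens r \<nu> \<in> S1_probs"
proof -
  have sets_\<nu>: "sets \<nu> = sets S1_borel" and "prob_space \<nu>" using assms by (auto simp: S1_probs_def)
  interpret prob_space \<nu> by fact
  have space: "space \<nu> = S1" using sets_eq_imp_space_eq[OF sets_\<nu>] by simp
  have sets_Phi: "sets (Phi dens r \<nu>) = sets S1_borel" by (simp add: Phi_dens)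
  have "emeasure (Phi dens r \<nu>) S1 = ennreal r + ennreal (1 - r) * 1"
    using emeasure_space_1 sets.top[of S1_borel]
    by (subst emeasure_Phi_dens[OF sets_\<nu>]) (simp_all add: space emeasure_base_measure_S1)
  also have "\<dots> = 1"
    using r_nonneg r_less_1 by (simp flip: ennreal_plus)
  finally have "prob_space (Phi dens r \<nu>)"
    using sets_eq_imp_space_eq[OF sets_Phi] by (intro prob_spaceI) simp
  then show ?thesis using sets_Phi by (simp add: S1_probs_def)
qed

text \<open>The periodic part contributes \<open>(1 - r) * (pi / 2)\<close>, exactly the amount by
  which the potential of \<open>base_measure\<close> falls short.\<close>

lemma nn_integral_sph_dist_Phi:
  assumes \<nu>: "\<nu> \<in> S1_probs" "pi_periodic \<nu>" and Q: "Q \<in> S1"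
  shows "(\<integral>\<^sup>+x. ennreal (sph_dist x Q) \<partial>Phi dens r \<nu>) = ennreal (sph_dist P Q)"
proof -
  have sets_\<nu>: "sets \<nu> = sets S1_borel" using \<nu> by (auto simp: S1_probs_def)
  have "(\<integral>\<^sup>+x. ennreal (sph_dist x Q) \<partial>Phi dens r \<nu>)
      = ennreal (sph_dist P Q - (1 - r) * (pi / 2)) + ennreal (1 - r) * ennreal (pi / 2)"
    unfolding Phi_dens using measurable_sph_dist[OF Q] sets_\<nu>
    by (subst nn_integral_add_measure)
      (simp_all add: nn_integral_scale_measure nn_integral_sph_dist_base_measure(1)[OF Q] nn_integral_sph_dist_periodic[OF \<nu> Q])
  also have "\<dots> = ennreal (sph_dist P Q)"
    using nn_integral_sph_dist_base_measure(2)[OF Q] r_less_1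
    by (simp flip: ennreal_plus ennreal_mult)
  finally show ?thesis .
qed

text \<open>The finite \<open>base_measure\<close> and then the positive factor \<open>1 - r\<close>
  can be cancelled.\<close>

lemma inj_on_Phi_dens: "inj_on (Phi dens r) S1_probs"
proof (rule inj_onI)
  fix \<nu> \<nu>' assume \<nu>: "\<nu> \<in> S1_probs" "\<nu>' \<in> S1_probs" and eq: "Phi dens r \<nu> = Phi dens r \<nu>'"
  have sets: "sets \<nu> = sets S1_borel" "sets \<nu>' = sets S1_borel" using \<nu> by (auto simp: S1_probs_def)
  interpret finite_measure base_measure by (rule finite_measure_base_measure)
  show "\<nu> = \<nu>'"
  proof (rule measure_eqI)
    fix A assume "A \<in> sets \<nu>"
    then have A: "A \<in> sets S1_borel" using sets by simp
    have "emeasure base_measure A + ennreal (1 - r) * emeasure \<nu> A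
        = emeasure base_measure A + ennreal (1 - r) * emeasure \<nu>' A"
      using emeasure_Phi_dens[OF sets(1) A] emeasure_Phi_dens[OF sets(2) A] eq by simp
    then have "ennreal (1 - r) * emeasure \<nu> A = ennreal (1 - r) * emeasure \<nu>' A"
      using emeasure_finite[of A] by (simp add: ennreal_add_left_cancel)
    then show "emeasure \<nu> A = emeasure \<nu>' A"
      using r_less_1 by (simp add: ennreal_mult_cancel_left)
  qed (simp add: sets)
qed

text \<open>The equality of antipodal differences of \<open>\<mu>\<close> and
  \<open>base_measure\<close>, rearranged to avoid subtraction. The potential of
  \<open>\<mu>\<close> plus the reflected base measure is \<open>d(P, Q) + d(P, -Q)\<close> up to a
  constant; as these distances add up to \<open>pi\<close>, it is constant and the sum is
  antipodally invariant.\<close>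

lemma emeasure_antipodal_balance:
  assumes \<mu>: "\<mu> \<in> S1_probs"
    and dist: "\<And>Q. Q \<in> S1 \<Longrightarrow> (\<integral>\<^sup>+x. ennreal (sph_dist x Q) \<partial>\<mu>) = ennreal (sph_dist P Q)"
    and A: "A \<in> sets S1_borel"
  shows "emeasure \<mu> (uminus -` A \<inter> S1) + emeasure base_measure A
    = emeasure \<mu> A + emeasure base_measure (uminus -` A \<inter> S1)"
proof -
  have sets_\<mu>: "sets \<mu> = sets S1_borel" and "prob_space \<mu>" using \<mu> by (auto simp: S1_probs_def)
  interpret prob_space \<mu> by fact
  let ?T = "distr base_measure S1_borel uminus"
  let ?\<sigma> = "add_measure \<mu> ?T"
  have um: "uminus \<in> base_measure \<rightarrow>\<^sub>M S1_borel" by (rule measurable_uminus_S1) simp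
  have space_b: "space base_measure = S1" using sets_eq_imp_space_eq[OF sets_base_measure] by simp
  have sets_\<sigma>: "sets ?\<sigma> = sets S1_borel" by (simp add: sets_\<mu>)
  have space_\<sigma>: "space ?\<sigma> = S1" using sets_eq_imp_space_eq[OF sets_\<sigma>] by simp
  have "distr ?\<sigma> S1_borel uminus = ?\<sigma>"
  proof (rule antipodal_invariant_if_constant_distance[OF _ sets_\<sigma>])
    show "finite_measure ?\<sigma>"
      using finite_measure.finite_measure_distr[OF finite_measure_base_measure um] sets_\<mu>
      by (intro finite_measure_add_measure finite_measure_axioms) simp_all
    fix Q assume Q: "Q \<in> S1"
    have "(\<integral>\<^sup>+x. ennreal (sph_dist x Q) \<partial>?\<sigma>) = (\<integral>\<^sup>+x. ennreal (sph_dist x Q) \<partial>\<mu>) + (\<integral>\<^sup>+x. ennreal (sph_dist x Q) \<partial>?T)"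
      using measurable_sph_dist[OF Q sets_\<mu>] sets_\<mu> by (intro nn_integral_add_measure) simp_all
    also have "\<dots> = ennreal (sph_dist P Q) + ennreal (sph_dist P (- Q) - (1 - r) * (pi / 2))"
      using Q by (simp add: dist nn_integral_sph_dist_uminus nn_integral_sph_dist_base_measure(1))
    also have "\<dots> = ennreal (sph_dist P Q + (sph_dist P (- Q) - (1 - r) * (pi / 2)))"
      using sph_dist_P_bounds[OF Q] nn_integral_sph_dist_base_measure(2)[of "- Q"] Q by (intro ennreal_plus[symmetric]) auto
    also have "sph_dist P Q + (sph_dist P (- Q) - (1 - r) * (pi / 2)) = pi - (1 - r) * (pi / 2)"
      by (simp add: sph_dist_P_uminus Q)
    finally show "(\<integral>\<^sup>+x. ennreal (sph_dist x Q) \<partial>?\<sigma>) = ennreal (pi - (1 - r) * (pi / 2))" .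
  qed
  then have inv: "emeasure ?\<sigma> (uminus -` A \<inter> S1) = emeasure ?\<sigma> A"
    using emeasure_distr[OF measurable_uminus_S1[OF sets_\<sigma>] A] space_\<sigma> by simp
  have negA: "uminus -` A \<inter> S1 \<in> sets S1_borel"
    using measurable_sets[OF um A] by (simp add: space_b)
  have neg_neg: "uminus -` (uminus -` A \<inter> S1) \<inter> S1 = A"
    using A by (auto simp: sets_S1_borel_iff)
  show ?thesis
    using inv A negA emeasure_distr[OF um A, unfolded space_b] emeasure_distr[OF um negA, unfolded space_b neg_neg]
    by (simp add: emeasure_add_measure sets_\<mu>)
qed

text \<open>Where \<open>dens\<close> is positive, it vanishes at the antipode, so the balance bounds \<open>\<mu>\<close> from below there.\<close>

lemma base_measure_le:
  assumes \<mu>: "\<mu> \<in> S1_probs"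
    and dist: "\<And>Q. Q \<in> S1 \<Longrightarrow> (\<integral>\<^sup>+x. ennreal (sph_dist x Q) \<partial>\<mu>) = ennreal (sph_dist P Q)"
    and A: "A \<in> sets S1_borel"
  shows "emeasure base_measure A \<le> emeasure \<mu> A"
proof -
  have sets_\<mu>: "sets \<mu> = sets S1_borel" using \<mu> by (auto simp: S1_probs_def)
  have null: "emeasure base_measure B = 0" if "B \<in> sets S1_borel" "\<And>x. x \<in> B \<Longrightarrow> P \<bullet> x \<le> 0" for B
  proof -
    have "emeasure base_measure B = (\<integral>\<^sup>+x. ennreal (dens x) * indicator B x \<partial>S1_hausdorff1)"
      unfolding base_measure_def using that(1) by (intro emeasure_density) simp_all
    also have "\<dots> = (\<integral>\<^sup>+x. 0 \<partial>S1_hausdorff1)"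
    proof (rule nn_integral_cong)
      fix x
      show "ennreal (dens x) * indicator B x = 0"
        using that dens_eq_0_iff[of x] by (cases "x \<in> B") (auto simp: sets_S1_borel_iff)
    qed
    finally show ?thesis by simp
  qed
  define A\<^sub>1 where "A\<^sub>1 = A \<inter> {x. 0 < P \<bullet> x}"
  have "open {x. 0 < P \<bullet> x}" by (intro open_Collect_less continuous_intros)
  then have A\<^sub>1: "A\<^sub>1 \<in> sets S1_borel"
    using A by (auto simp: A\<^sub>1_def sets_S1_borel_iff)
  have "uminus -` A\<^sub>1 \<inter> S1 \<in> sets S1_borel"
    using measurable_sets[OF measurable_uminus_S1[OF refl] A\<^sub>1] by simp
  then have null_neg: "emeasure base_measure (uminus -` A\<^sub>1 \<inter> S1) = 0"
    by (rule null) (auto simp: A\<^sub>1_def)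
  have "emeasure base_measure A \<le> emeasure base_measure A\<^sub>1 + emeasure base_measure (A - A\<^sub>1)"
    using A A\<^sub>1 emeasure_subadditive[of A\<^sub>1 base_measure "A - A\<^sub>1"]
    by (simp add: A\<^sub>1_def Un_Diff_Int Int_commute sets.Diff)
  also have "emeasure base_measure (A - A\<^sub>1) = 0"
    using A A\<^sub>1 by (intro null) (auto simp: A\<^sub>1_def)
  also have "emeasure base_measure A\<^sub>1 + 0 \<le> emeasure \<mu> (uminus -` A\<^sub>1 \<inter> S1) + emeasure base_measure A\<^sub>1"
    by simp
  also have "\<dots> = emeasure \<mu> A\<^sub>1"
    by (simp add: emeasure_antipodal_balance[OF \<mu> dist A\<^sub>1] null_neg)
  also have "\<dots> \<le> emeasure \<mu> A"
    using A by (intro emeasure_mono) (auto simp: A\<^sub>1_def sets_\<mu>)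
  finally show ?thesis .
qed

text \<open>The only candidate is \<open>(\<mu> - base_measure) / (1 - r)\<close>. It is nonnegative
  by \<open>base_measure_le\<close>, has mass 1 because \<open>base_measure\<close> has mass
  \<open>r\<close>, and is invariant by the balance identity.\<close>

lemma Phi_dens_surj:
  assumes \<mu>: "\<mu> \<in> S1_probs"
    and dist: "\<And>Q. Q \<in> S1 \<Longrightarrow> (\<integral>\<^sup>+x. ennreal (sph_dist x Q) \<partial>\<mu>) = ennreal (sph_dist P Q)"
  obtains \<nu> where "\<nu> \<in> S1_probs" "pi_periodic \<nu>" "Phi dens r \<nu> = \<mu>"
proof -
  have sets_\<mu>: "sets \<mu> = sets S1_borel" and "prob_space \<mu>" using \<mu> by (auto simp: S1_probs_def)
  interpret prob_space \<mu> by fact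
  interpret b: finite_measure base_measure by (rule finite_measure_base_measure)
  have space_\<mu>: "space \<mu> = S1" using sets_eq_imp_space_eq[OF sets_\<mu>] by simp
  define \<nu> where "\<nu> = scale_measure (ennreal (1 / (1 - r))) (diff_measure \<mu> base_measure)"
  have sets_\<nu>: "sets \<nu> = sets S1_borel" by (simp add: \<nu>_def sets_\<mu>)
  have space_\<nu>: "space \<nu> = S1" using sets_eq_imp_space_eq[OF sets_\<nu>] by simp
  have le: "emeasure base_measure A \<le> emeasure \<mu> A" if "A \<in> sets S1_borel" for A
    by (rule base_measure_le[OF \<mu> _ that]) (rule dist)
  have diff: "emeasure (diff_measure \<mu> base_measure) A = ennreal (measure \<mu> A - measure base_measure A)"
    if "A \<in> sets S1_borel" for A
    using that le by (subst emeasure_diff_measure)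
      (auto simp: sets_\<mu> finite_measure_axioms b.finite_measure_axioms emeasure_eq_measure b.emeasure_eq_measure ennreal_minus)
  have le': "measure base_measure A \<le> measure \<mu> A" if "A \<in> sets S1_borel" for A
    using le[OF that] by (simp add: emeasure_eq_measure b.emeasure_eq_measure)
  have emeasure_\<nu>: "emeasure \<nu> A = ennreal ((measure \<mu> A - measure base_measure A) / (1 - r))"
    if "A \<in> sets S1_borel" for A
    using that r_less_1 le'[OF that] by (simp add: \<nu>_def diff flip: ennreal_mult)
  have "measure base_measure S1 = r"
    using emeasure_base_measure_S1 r_nonneg by (simp add: b.emeasure_eq_measure)
  moreover have "measure \<mu> S1 = 1" using prob_space by (simp add: space_\<mu>)
  ultimately have "emeasure \<nu> S1 = 1"
    using r_less_1 sets.top[of S1_borel] by (simp add: emeasure_\<nu>)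
  then have \<nu>: "\<nu> \<in> S1_probs"
    by (auto simp: S1_probs_def sets_\<nu> space_\<nu> intro!: prob_spaceI)
  have "distr \<nu> S1_borel uminus = \<nu>"
  proof (rule measure_eqI)
    fix A assume "A \<in> sets (distr \<nu> S1_borel uminus)"
    then have A: "A \<in> sets S1_borel" by simp
    have negA: "uminus -` A \<inter> S1 \<in> sets S1_borel"
      using measurable_sets[OF measurable_uminus_S1[OF refl] A] by simp
    have "measure \<mu> (uminus -` A \<inter> S1) + measure base_measure A
        = measure \<mu> A + measure base_measure (uminus -` A \<inter> S1)"
      using emeasure_antipodal_balance[OF \<mu> dist A]
      by (simp add: emeasure_eq_measure b.emeasure_eq_measure flip: ennreal_plus)
    then have "measure \<mu> (uminus -` A \<inter> S1) - measure base_measure (uminus -` A \<inter> S1)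
        = measure \<mu> A - measure base_measure A" by simp
    then show "emeasure (distr \<nu> S1_borel uminus) A = emeasure \<nu> A"
      by (simp add: emeasure_distr[OF measurable_uminus_S1[OF sets_\<nu>] A] space_\<nu> emeasure_\<nu> A negA)
  qed (simp add: sets_\<nu>)
  then have "pi_periodic \<nu>" by (simp add: pi_periodic_def)
  moreover have "Phi dens r \<nu> = \<mu>"
  proof (rule measure_eqI)
    fix A assume "A \<in> sets (Phi dens r \<nu>)"
    then have A: "A \<in> sets S1_borel" by (simp add: Phi_dens)
    have "emeasure (Phi dens r \<nu>) A
        = ennreal (measure base_measure A) + ennreal (measure \<mu> A - measure base_measure A)"
      using r_less_1 le'[OF A]
      by (simp add: emeasure_Phi_dens[OF sets_\<nu> A] emeasure_\<nu>[OF A] b.emeasure_eq_measure flip: ennreal_mult)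
    also have "\<dots> = emeasure \<mu> A"
      using le'[OF A] by (simp add: emeasure_eq_measure flip: ennreal_plus)
    finally show "emeasure (Phi dens r \<nu>) A = emeasure \<mu> A" .
  qed (simp add: Phi_dens sets_\<mu>)
  ultimately show ?thesis using \<nu> that by blast
qed

lemma bij_betw_Phi_dens:
  "bij_betw (Phi dens r) {\<nu> \<in> S1_probs. pi_periodic \<nu>}
    {\<mu> \<in> S1_probs. \<forall>Q\<in>S1. wasserstein1 \<mu> (return S1_borel Q) = sph_dist P Q}" (is "bij_betw _ ?A ?B")
  unfolding bij_betw_def
proof
  show "inj_on (Phi dens r) ?A"
    using inj_on_Phi_dens by (rule inj_on_subset) blast
  have "?B = {\<mu> \<in> S1_probs. \<forall>Q\<in>S1. (\<integral>\<^sup>+x. ennreal (sph_dist x Q) \<partial>\<mu>) = ennreal (sph_dist P Q)}"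
    by (auto simp: wasserstein1_eq_sph_dist_P_iff)
  also have "\<dots> = Phi dens r ` ?A"
    by (auto simp: Phi_dens_in_S1_probs nn_integral_sph_dist_Phi image_iff elim: Phi_dens_surj)
  finally show "Phi dens r ` ?A = ?B" by simp
qed

end

text \<open>Nonnegativity of \<open>h\<close> is asserted as well, because \<open>ennreal\<close>
  inside \<open>Phi\<close> would silently replace negative values by 0.\<close>

theorem lemma1p6:
  fixes P :: "real^3"
  assumes "P \<in> H2 - S1"
  shows "\<exists>(h :: real^3 \<Rightarrow> real) (k :: real).
           continuous_on S1 h \<and> (\<forall>x\<in>S1. 0 \<le> h x) \<and> 0 \<le> k \<and> k < 1 \<and>
           bij_betw (Phi h k)
             {\<nu> \<in> S1_probs. pi_periodic \<nu>}
             {\<mu> \<in> S1_probs. \<forall>Q\<in>S1. wasserstein1 \<mu> (return S1_borel Q) = sph_dist P Q}"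
proof -
  have P: "0 < P $ 3" "(P $ 1)\<^sup>2 + (P $ 2)\<^sup>2 + (P $ 3)\<^sup>2 = 1"
    using assms by (auto simp: H2_def S1_def S2_def norm_eq_1 inner_vec3 power2_eq_square)
  obtain r \<phi> where r\<phi>: "0 \<le> r" "P $ 1 = r * cos \<phi>" "P $ 2 = r * sin \<phi>"
  proof -
    obtain s \<phi> where s: "P $ 1 = s * cos \<phi>" "P $ 2 = s * sin \<phi>" using polar_Ex by blast
    show ?thesis
    proof (cases "0 \<le> s")
      case True
      then show ?thesis using that s by blast
    next
      case False
      \<comment> \<open>Half a turn added to the angle makes a negative radius positive.\<close>
      then show ?thesis using that[of "- s" "\<phi> + pi"] s by simp
    qed
  qed
  have "r\<^sup>2 = (P $ 1)\<^sup>2 + (P $ 2)\<^sup>2"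
    by (simp add: r\<phi> power_mult_distrib flip: distrib_left)
  then have "r\<^sup>2 < 1" using P zero_less_power[OF P(1), of 2] by linarith
  then have "r < 1" using r\<phi>(1) by (simp add: abs_square_less_1)
  then interpret interior_point P r \<phi> using r\<phi> by unfold_locales
  show ?thesis
    using continuous_dens dens_nonneg r_nonneg r_less_1 bij_betw_Phi_dens by blast
qed

end
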